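(* Let $\lambda$ be a partition with at most $n$ parts and $\mu\in S_n(\lambda)$ with $|\mu|=d$. Then $f^*_\mu$ is the unique polynomial $g$ in $x_1,\dots,x_n$ of degree at most $d$ such that (i) $g(\widetilde\nu)=0$ for every $\nu\in\mathbb{N}^n$ with $|\nu|\le|\mu|$ and $\nu\notin S_n(\lambda)$, and (ii) for every $\tau\in S_n(\lambda)$, the coefficient of $x^\tau$ in $g$ equals $\delta_{\tau,\mu}$.
   Context: Polynomials are in $x_1,\dots,x_n$ over $\mathbb{Q}(q,t)$. For $\mu\in\mathbb{N}^n$ let $k_i(\mu)=\#\{j<i:\mu_j>\mu_i\}+\#\{j>i:\mu_j\ge\mu_i\}$ and $\widetilde\mu=(q^{\mu_1}t^{-k_1(\mu)},\dots,q^{\mu_n}t^{-k_n(\mu)})$. For $\mu\in\mathbb{N}^n$, $|\mu|=d$, $E^*_\mu$ is the unique polynomial of degree at most $d$ with coefficient of $x^\mu$ equal to $1$ and $E^*_\mu(\widetilde\nu)=0$ for all $\nu\in\mathbb{N}^n$, $|\nu|\le d$, $\nu\ne\mu$. $S_n$ acts on compositions by $\sigma\cdot\mu=(\mu_{\sigma^{-1}(1)},\dots,\mu_{\sigma^{-1}(n)})$ and on polynomials by permuting variables; $s_i=(i,i+1)$; $T_i=t-\frac{tx_i-x_{i+1}}{x_i-x_{i+1}}(1-s_i)$; $T_\sigma=T_{i_1}\cdots T_{i_\ell}$ for a reduced word. $S_n(\lambda)$ is the set of rearrangements of $\lambda$; for $\mu\in S_n(\lambda)$, $\sigma_\mu$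 is the shortest permutation with $\sigma_\mu(\lambda)=\mu$, and $f^*_\mu=T_{\sigma_\mu}E^*_\lambda$. *)

theory Defs
  imports "HOL-Library.Poly_Mapping" "HOL-Computational_Algebra.Polynomial"
    "HOL-Computational_Algebra.Fraction_Field" "HOL-Combinatorics.Permutations"
begin

type_synonym K = "rat poly poly fract"

definition qq :: K where "qq = Fract [:0, 1:] 1"
definition tt :: K where "tt = Fract [:[:0, 1:]:] 1"

section \<open>Polynomials in x_0,...,x_{n-1} over K (variables 0-indexed)\<close>

type_synonym mpoly = "(nat \<Rightarrow>\<^sub>0 nat) \<Rightarrow>\<^sub>0 K"

definition Xv :: "nat \<Rightarrow> mpoly" where
  "Xv i = Poly_Mapping.single (Poly_Mapping.single i 1) 1"

definition Cst :: "K \<Rightarrow> mpoly" where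
  "Cst c = Poly_Mapping.single 0 c"

definition tdeg :: "(nat \<Rightarrow>\<^sub>0 nat) \<Rightarrow> nat" where
  "tdeg m = (\<Sum>i\<in>Poly_Mapping.keys m. Poly_Mapping.lookup m i)"

definition in_vars :: "nat \<Rightarrow> mpoly \<Rightarrow> bool" where
  "in_vars n g \<longleftrightarrow> (\<forall>m\<in>Poly_Mapping.keys g. Poly_Mapping.keys m \<subseteq> {..<n})"

definition deg_le :: "mpoly \<Rightarrow> nat \<Rightarrow> bool" where
  "deg_le g d \<longleftrightarrow> (\<forall>m\<in>Poly_Mapping.keys g. tdeg m \<le> d)"

definition peval :: "mpoly \<Rightarrow> (nat \<Rightarrow> K) \<Rightarrow> K" where
  "peval g x = (\<Sum>m\<in>Poly_Mapping.keys g. Poly_Mapping.lookup g m * (\<Prod>i\<in>Poly_Mapping.keys m. x i ^ Poly_Mapping.lookup m i))"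

definition is_comp :: "nat \<Rightarrow> (nat \<Rightarrow> nat) \<Rightarrow> bool" where
  "is_comp n \<mu> \<longleftrightarrow> (\<forall>i\<ge>n. \<mu> i = 0)"

definition csize :: "nat \<Rightarrow> (nat \<Rightarrow> nat) \<Rightarrow> nat" where
  "csize n \<mu> = (\<Sum>i<n. \<mu> i)"

definition coeffx :: "mpoly \<Rightarrow> (nat \<Rightarrow> nat) \<Rightarrow> K" where
  "coeffx g \<mu> = Poly_Mapping.lookup g (Abs_poly_mapping \<mu>)"

definition kk :: "nat \<Rightarrow> (nat \<Rightarrow> nat) \<Rightarrow> nat \<Rightarrow> nat" where
  "kk n \<mu> i = card {j. j < i \<and> \<mu> j > \<mu> i} + card {j. i < j \<and> j < n \<and> \<mu> j \<ge> \<mu> i}"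

definition tilde :: "nat \<Rightarrow> (nat \<Rightarrow> nat) \<Rightarrow> nat \<Rightarrow> K" where
  "tilde n \<mu> i = (if i < n then qq ^ \<mu> i / tt ^ kk n \<mu> i else 0)"

definition Estar :: "nat \<Rightarrow> (nat \<Rightarrow> nat) \<Rightarrow> mpoly" where
  "Estar n \<mu> = (THE g. in_vars n g \<and> deg_le g (csize n \<mu>) \<and> coeffx g \<mu> = 1 \<and>
      (\<forall>\<nu>. is_comp n \<nu> \<and> csize n \<nu> \<le> csize n \<mu> \<and> \<nu> \<noteq> \<mu> \<longrightarrow> peval g (tilde n \<nu>) = 0))"

definition act :: "(nat \<Rightarrow> nat) \<Rightarrow> (nat \<Rightarrow> nat) \<Rightarrow> (nat \<Rightarrow> nat)" where
  "act \<sigma> \<mu> = \<mu> \<circ> inv \<sigma>"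

definition swap_poly :: "nat \<Rightarrow> mpoly \<Rightarrow> mpoly" where
  "swap_poly i g = Abs_poly_mapping (\<lambda>m. Poly_Mapping.lookup g
      (Abs_poly_mapping (Poly_Mapping.lookup m \<circ> Transposition.transpose i (Suc i))))"

text \<open>T_i g = t g - (t x_i - x_{i+1})/(x_i - x_{i+1}) (g - s_i g); the division is exact,
  so T_i g is the unique h with h (x_i - x_{i+1}) = t g (x_i - x_{i+1}) - (t x_i - x_{i+1})(g - s_i g).\<close>
definition Top :: "nat \<Rightarrow> mpoly \<Rightarrow> mpoly" where
  "Top i g = (THE h. h * (Xv i - Xv (Suc i)) =
      Cst tt * g * (Xv i - Xv (Suc i)) - (Cst tt * Xv i - Xv (Suc i)) * (g - swap_poly i g))"

definition inv_count :: "nat \<Rightarrow> (nat \<Rightarrow> nat) \<Rightarrow> nat" where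
  "inv_count n \<sigma> = card {(i, j). i < j \<and> j < n \<and> \<sigma> i > \<sigma> j}"

definition reduced_word :: "nat \<Rightarrow> (nat \<Rightarrow> nat) \<Rightarrow> nat list \<Rightarrow> bool" where
  "reduced_word n \<sigma> w \<longleftrightarrow> (\<forall>i\<in>set w. Suc i < n) \<and>
      \<sigma> = foldr (\<lambda>i \<tau>. Transposition.transpose i (Suc i) \<circ> \<tau>) w id \<and>
      length w = inv_count n \<sigma>"

definition Tperm :: "nat \<Rightarrow> (nat \<Rightarrow> nat) \<Rightarrow> mpoly \<Rightarrow> mpoly" where
  "Tperm n \<sigma> g = foldr Top (SOME w. reduced_word n \<sigma> w) g"

definition is_partition :: "nat \<Rightarrow> (nat \<Rightarrow> nat) \<Rightarrow> bool" where
  "is_partition n lam \<longleftrightarrow> is_comp n lam \<and> (\<forall>i j. i \<le> j \<and> j < n \<longrightarrow> lam j \<le> lam i)"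

definition Sn :: "nat \<Rightarrow> (nat \<Rightarrow> nat) \<Rightarrow> (nat \<Rightarrow> nat) set" where
  "Sn n lam = {\<mu>. \<exists>\<sigma>. (\<sigma> permutes {..<n}) \<and> \<mu> = act \<sigma> lam}"

definition sigma_of :: "nat \<Rightarrow> (nat \<Rightarrow> nat) \<Rightarrow> (nat \<Rightarrow> nat) \<Rightarrow> (nat \<Rightarrow> nat)" where
  "sigma_of n lam \<mu> = (THE \<sigma>. (\<sigma> permutes {..<n}) \<and> act \<sigma> lam = \<mu> \<and>
      (\<forall>\<tau>. (\<tau> permutes {..<n}) \<and> act \<tau> lam = \<mu> \<longrightarrow> inv_count n \<sigma> \<le> inv_count n \<tau>))"

definition fstar :: "nat \<Rightarrow> (nat \<Rightarrow> nat) \<Rightarrow> (nat \<Rightarrow> nat) \<Rightarrow> mpoly" where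
  "fstar n lam \<mu> = Tperm n (sigma_of n lam \<mu>) (Estar n lam)"

definition fchar :: "nat \<Rightarrow> (nat \<Rightarrow> nat) \<Rightarrow> (nat \<Rightarrow> nat) \<Rightarrow> mpoly \<Rightarrow> bool" where
  "fchar n lam \<mu> g \<longleftrightarrow> in_vars n g \<and> deg_le g (csize n \<mu>) \<and>
     (\<forall>\<nu>. is_comp n \<nu> \<and> csize n \<nu> \<le> csize n \<mu> \<and> \<nu> \<notin> Sn n lam \<longrightarrow> peval g (tilde n \<nu>) = 0) \<and>
     (\<forall>\<tau>\<in>Sn n lam. coeffx g \<tau> = (if \<tau> = \<mu> then 1 else 0))"

end

theory Submission
  imports Defs
begin

text \<open>
  Interpolation at the nodes \<open>\<nu>~\<close> is uniquely solvable: dividing by \<open>x\<^sub>1 - t\<^bsup>-(n-1)\<^esup>\<close> separates the nodes with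
  \<open>\<nu>\<^sub>1 = 0\<close>, where one variable is eliminated, from the others, which are reached through the raising map
  \<open>\<Phi>(\<nu>\<^sub>1, \<dots>, \<nu>\<^sub>n) = (\<nu>\<^sub>n + 1, \<nu>\<^sub>1, \<dots>, \<nu>\<^bsub>n-1\<^esub>)\<close>. On polynomials \<open>\<Phi>\<close> acts by
  \<open>g \<mapsto> (x\<^sub>1 - t\<^bsup>-(n-1)\<^esup>) g(x\<^sub>2, \<dots>, x\<^sub>n, x\<^sub>1 / q)\<close> and sends \<open>E\<^sup>*\<^sub>\<mu>\<close> to a multiple of \<open>E\<^sup>*\<^bsub>\<Phi>\<mu>\<^esub>\<close>.

  The operators \<open>T\<^sub>i\<close> preserve vanishing on \<open>S\<^sub>n\<close>-stable sets of nodes. On monomials of top degree they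
  permute each orbit \<open>S\<^sub>n(\<lambda>)\<close> up to coefficients, and otherwise produce only monomials that are strictly
  smaller in dominance order. So everything follows once the top part of \<open>E\<^sup>*\<^sub>\<mu>\<close> is known to involve only
  monomials dominated by \<open>\<mu>\<close> and, inside the orbit, only \<open>x\<^sup>\<mu>\<close> and monomials with fewer ascents. For a partition
  \<open>\<lambda>\<close> with \<open>k\<close> nonzero parts this is inherited from \<open>(0, \<dots>, 0, \<lambda>\<^sub>1 - 1, \<dots>, \<lambda>\<^sub>k - 1)\<close> by applying \<open>\<Phi>\<close> \<open>k\<close> times; the
  other elements of the orbit are reached by the \<open>T\<^sub>i\<close>.
\<close>

abbreviation lookup :: "('a \<Rightarrow>\<^sub>0 'b::zero) \<Rightarrow> 'a \<Rightarrow> 'b" where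
  "lookup \<equiv> Poly_Mapping.lookup"

abbreviation keys :: "('a \<Rightarrow>\<^sub>0 'b::zero) \<Rightarrow> 'a set" where
  "keys \<equiv> Poly_Mapping.keys"

abbreviation single :: "'a \<Rightarrow> 'b::zero \<Rightarrow> 'a \<Rightarrow>\<^sub>0 'b" where
  "single \<equiv> Poly_Mapping.single"

section \<open>Evaluation and coefficients\<close>

lemma poly_mapping_sum_single: "(\<Sum>m\<in>keys g. single m (lookup g m)) = g"
proof (rule poly_mapping_eqI)
  fix m
  have "lookup (\<Sum>m\<in>keys g. single m (lookup g m)) m = (\<Sum>k\<in>keys g. if k = m then lookup g k else 0)"
    unfolding lookup_sum by (rule sum.cong) (auto simp: lookup_single when_def)
  also have "\<dots> = lookup g m"
    by (simp add: in_keys_iff)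
  finally show "lookup (\<Sum>m\<in>keys g. single m (lookup g m)) m = lookup g m" .
qed

definition mon_eval :: "(nat \<Rightarrow> K) \<Rightarrow> (nat \<Rightarrow>\<^sub>0 nat) \<Rightarrow> K" where
  "mon_eval x m = (\<Prod>i\<in>keys m. x i ^ lookup m i)"

lemma mon_eval_superset:
  assumes "finite A" "keys m \<subseteq> A"
  shows "mon_eval x m = (\<Prod>i\<in>A. x i ^ lookup m i)"
  unfolding mon_eval_def
  by (rule prod.mono_neutral_left) (use assms in \<open>auto simp: in_keys_iff\<close>)

lemma mon_eval_add: "mon_eval x (m + m') = mon_eval x m * mon_eval x m'"
proof -
  let ?A = "keys m \<union> keys m'"
  have "keys (m + m') \<subseteq> ?A" by (rule keys_add)
  then show ?thesis
    by (simp add: mon_eval_superset[of ?A] prod.distrib lookup_add power_add)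
qed

lemma peval_superset:
  assumes "finite A" "keys g \<subseteq> A"
  shows "peval g x = (\<Sum>m\<in>A. lookup g m * mon_eval x m)"
  unfolding peval_def mon_eval_def
  by (rule sum.mono_neutral_left) (use assms in \<open>auto simp: in_keys_iff\<close>)

lemma peval_0 [simp]: "peval 0 x = 0"
  by (simp add: peval_def)

lemma peval_add: "peval (f + g) x = peval f x + peval g x"
proof -
  let ?A = "keys f \<union> keys g"
  have "keys (f + g) \<subseteq> ?A" by (rule keys_add)
  then show ?thesis
    by (simp add: peval_superset[of ?A] sum.distrib lookup_add distrib_right)
qed

lemma peval_minus: "peval (f - g) x = peval f x - peval g x"
  using peval_add[of "f - g" g x] by simp

lemma peval_sum: "peval (\<Sum>i\<in>I. f i) x = (\<Sum>i\<in>I. peval (f i) x)"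
  by (induction I rule: infinite_finite_induct) (auto simp: peval_add)

lemma peval_single: "peval (single m c) x = c * mon_eval x m"
  by (subst peval_superset[of "{m}"]) auto

lemma peval_mult: "peval (f * g) x = peval f x * peval g x"
proof -
  have "f * g = (\<Sum>m\<in>keys f. \<Sum>k\<in>keys g. single (m + k) (lookup f m * lookup g k))"
    by (subst (1) poly_mapping_sum_single[of f, symmetric],
        subst (1) poly_mapping_sum_single[of g, symmetric])
      (simp add: sum_product mult_single)
  then have "peval (f * g) x = (\<Sum>m\<in>keys f. \<Sum>k\<in>keys g. (lookup f m * mon_eval x m) * (lookup g k * mon_eval x k))"
    by (simp add: peval_sum peval_single mon_eval_add mult_ac)
  also have "\<dots> = peval f x * peval g x"
    by (simp add: sum_product peval_superset[of "keys f" f] peval_superset[of "keys g" g])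
  finally show ?thesis .
qed

lemma peval_Xv [simp]: "peval (Xv i) x = x i"
  unfolding Xv_def peval_single by (simp add: mon_eval_def)

lemma peval_Cst [simp]: "peval (Cst c) x = c"
  unfolding Cst_def peval_single by (simp add: mon_eval_def)

lemma lookup_Cst_mult [simp]: "lookup (Cst c * g) m = c * lookup g m"
  unfolding Cst_def mult_map_scale_conv_mult[symmetric]
  by (simp add: Poly_Mapping.map.rep_eq when_def)

lemma coeffx_Cst_mult [simp]: "coeffx (Cst c * g) \<mu> = c * coeffx g \<mu>"
  by (simp add: coeffx_def)

lemma coeffx_sum: "coeffx (\<Sum>i\<in>I. f i) \<mu> = (\<Sum>i\<in>I. coeffx (f i) \<mu>)"
  by (simp add: coeffx_def lookup_sum)

lemma Xv_mult_eq: "Xv i * g = (\<Sum>k\<in>keys g. single (single i 1 + k) (lookup g k))"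
  by (subst poly_mapping_sum_single[of g, symmetric])
    (simp add: Xv_def sum_distrib_left mult_single)

text \<open>Together with \<open>lookup_Xv_mult_0\<close> this gives all coefficients of
  \<open>Xv i * g\<close>: a monomial is either divisible by the variable or not.\<close>

lemma lookup_Xv_mult [simp]: "lookup (Xv i * g) (single i 1 + k) = lookup g k"
proof -
  have "lookup (Xv i * g) (single i 1 + k) = (\<Sum>k'\<in>keys g. if k' = k then lookup g k' else 0)"
    unfolding Xv_mult_eq lookup_sum by (rule sum.cong) (auto simp: lookup_single when_def)
  then show ?thesis by (simp add: in_keys_iff)
qed

lemma lookup_Xv_mult_0: "lookup m i = 0 \<Longrightarrow> lookup (Xv i * g) m = 0"
  unfolding Xv_mult_eq lookup_sum
  by (rule sum.neutral) (auto simp: lookup_single when_def lookup_add)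

section \<open>Polynomials in given variables of bounded degree\<close>

lemma tdeg_superset:
  assumes "finite A" "keys m \<subseteq> A"
  shows "tdeg m = (\<Sum>i\<in>A. lookup m i)"
  unfolding tdeg_def
  by (rule sum.mono_neutral_left) (use assms in \<open>auto simp: in_keys_iff\<close>)

lemma tdeg_add: "tdeg (m + m') = tdeg m + tdeg m'"
proof -
  let ?A = "keys m \<union> keys m'"
  have "keys (m + m') \<subseteq> ?A" by (rule keys_add)
  then show ?thesis
    by (simp add: tdeg_superset[of ?A] sum.distrib lookup_add)
qed

lemma tdeg_single [simp]: "tdeg (single i a) = a"
  by (subst tdeg_superset[of "{i}"]) auto

text \<open>The degree bound is strict, so that bound \<open>0\<close> leaves only the zero polynomial.\<close>

definition poly_in :: "nat set \<Rightarrow> nat \<Rightarrow> mpoly \<Rightarrow> bool" where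
  "poly_in A d g \<longleftrightarrow> (\<forall>m. lookup g m \<noteq> 0 \<longrightarrow> keys m \<subseteq> A \<and> tdeg m < d)"

lemma poly_in_iff: "poly_in {..<n} (Suc d) g \<longleftrightarrow> in_vars n g \<and> deg_le g d"
  by (auto simp: poly_in_def in_vars_def deg_le_def in_keys_iff less_Suc_eq_le)

lemma poly_in_zero_bound: "poly_in A 0 g \<Longrightarrow> g = 0"
  by (auto simp: poly_in_def intro: poly_mapping_eqI)

lemma poly_in_0 [simp]: "poly_in A d 0"
  by (simp add: poly_in_def)

lemma poly_in_add: "poly_in A d f \<Longrightarrow> poly_in A d g \<Longrightarrow> poly_in A d (f + g)"
  unfolding poly_in_def lookup_add by (metis add_0)

lemma poly_in_minus: "poly_in A d f \<Longrightarrow> poly_in A d g \<Longrightarrow> poly_in A d (f - g)"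
  unfolding poly_in_def lookup_minus by (metis diff_0_right diff_self)

lemma poly_in_sum: "(\<And>i. i \<in> I \<Longrightarrow> poly_in A d (f i)) \<Longrightarrow> poly_in A d (\<Sum>i\<in>I. f i)"
  by (induction I rule: infinite_finite_induct) (auto simp: poly_in_add)

lemma poly_in_Cst_mult: "poly_in A d g \<Longrightarrow> poly_in A d (Cst c * g)"
  by (auto simp: poly_in_def)

lemma poly_in_mono: "poly_in A d g \<Longrightarrow> A \<subseteq> B \<Longrightarrow> d \<le> e \<Longrightarrow> poly_in B e g"
  unfolding poly_in_def by (meson less_le_trans subset_trans)

lemma poly_in_Xv_mult:
  assumes "poly_in A d g" "i \<in> A"
  shows "poly_in A (Suc d) (Xv i * g)"
  unfolding poly_in_def
proof (intro allI impI)
  fix m assume nz: "lookup (Xv i * g) m \<noteq> 0"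
  then have "lookup m i \<noteq> 0" using lookup_Xv_mult_0 by blast
  \<comment> \<open>The variable divides \<open>m\<close>, so the truncated subtraction of exponents
    is exact.\<close>
  then have "m = single i 1 + (m - single i 1)"
    by (intro poly_mapping_eqI) (auto simp: lookup_add lookup_minus lookup_single when_def)
  then obtain k where m: "m = single i 1 + k" by blast
  have "lookup g k \<noteq> 0" using nz lookup_Xv_mult[of i g k] m by simp
  then have k: "keys k \<subseteq> A" "tdeg k < d" using assms by (auto simp: poly_in_def)
  have "keys m \<subseteq> insert i (keys k)"
    using keys_add[of "single i (1::nat)" k] m by simp
  moreover have "tdeg m = Suc (tdeg k)" using tdeg_add[of "single i (1::nat)" k] m by simp
  ultimately show "keys m \<subseteq> A \<and> tdeg m < Suc d" using k assms(2) by auto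
qed

text \<open>Monomials are divided one at a time, by induction on the exponent of \<open>x_k\<close>:
  \<open>x_k^(a+1) m = (x_k - c) x_k^a m + c x_k^a m\<close>, where the last term is of the same
  kind with a smaller exponent and a new coefficient.\<close>

lemma linear_division:
  assumes g: "poly_in A (Suc d) g" and k: "k \<in> A"
  shows "\<exists>r h. g = r + (Xv k - Cst c) * h \<and> poly_in (A - {k}) (Suc d) r \<and> poly_in A d h"
proof -
  have mon: "\<exists>r h. single (m + single k a) v = r + (Xv k - Cst c) * h \<and>
      poly_in (A - {k}) (Suc d) r \<and> poly_in A d h"
    if "keys m \<subseteq> A - {k}" "tdeg m + a \<le> d" for m a v
    using that
  proof (induction a arbitrary: v)
    case 0
    then have "poly_in (A - {k}) (Suc d) (single m v)"
      by (auto simp: poly_in_def lookup_single when_def)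
    then show ?case by (intro exI[of _ "single m v"] exI[of _ 0]) auto
  next
    case (Suc a)
    let ?s = "single (m + single k a) v"
    obtain r h where rh: "single (m + single k a) (c * v) = r + (Xv k - Cst c) * h"
      "poly_in (A - {k}) (Suc d) r" "poly_in A d h"
      using Suc.IH[of "c * v"] Suc.prems by auto
    have sk: "single k (Suc a) = single k 1 + single k a"
      by (metis plus_1_eq_Suc single_add)
    have "single (m + single k (Suc a)) v = Xv k * ?s"
      unfolding sk by (simp add: Xv_def mult_single add_ac)
    moreover have "single (m + single k a) (c * v) = Cst c * ?s"
      by (simp add: Cst_def mult_single)
    ultimately have "single (m + single k (Suc a)) v = r + (Xv k - Cst c) * (h + ?s)"
      using rh(1) by (simp add: algebra_simps)
    moreover have "poly_in A d ?s"
      using Suc.prems k keys_add[of m "single k a"]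
      by (auto simp: poly_in_def lookup_single when_def tdeg_add split: if_splits)
    ultimately show ?case using rh poly_in_add by blast
  qed
  have "\<forall>m\<in>keys g. \<exists>r h. single m (lookup g m) = r + (Xv k - Cst c) * h \<and>
      poly_in (A - {k}) (Suc d) r \<and> poly_in A d h"
  proof
    fix m assume m: "m \<in> keys g"
    define m0 where "m0 = m - single k (lookup m k)"
    have eq: "m = m0 + single k (lookup m k)"
      unfolding m0_def by (rule poly_mapping_eqI) (auto simp: lookup_add lookup_minus lookup_single when_def)
    have mA: "keys m \<subseteq> A" "tdeg m \<le> d"
      using g m by (auto simp: poly_in_def in_keys_iff)
    have "keys m0 \<subseteq> A - {k}"
      using mA(1) by (auto simp: m0_def in_keys_iff lookup_minus lookup_single when_def split: if_splits)
    moreover have "tdeg m0 + lookup m k \<le> d"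
      using mA(2) tdeg_add[of m0 "single k (lookup m k)", folded eq] by simp
    ultimately show "\<exists>r h. single m (lookup g m) = r + (Xv k - Cst c) * h \<and>
      poly_in (A - {k}) (Suc d) r \<and> poly_in A d h"
      using mon[of m0 "lookup m k"] eq by metis
  qed
  then obtain r h where rh: "\<And>m. m \<in> keys g \<Longrightarrow> single m (lookup g m) = r m + (Xv k - Cst c) * h m \<and>
      poly_in (A - {k}) (Suc d) (r m) \<and> poly_in A d (h m)"
    by metis
  have "g = (\<Sum>m\<in>keys g. r m + (Xv k - Cst c) * h m)"
    by (subst poly_mapping_sum_single[of g, symmetric], rule sum.cong) (use rh in auto)
  then have "g = (\<Sum>m\<in>keys g. r m) + (Xv k - Cst c) * (\<Sum>m\<in>keys g. h m)"
    by (simp add: sum.distrib sum_distrib_left)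
  moreover have "poly_in (A - {k}) (Suc d) (\<Sum>m\<in>keys g. r m)" "poly_in A d (\<Sum>m\<in>keys g. h m)"
    using rh by (auto intro!: poly_in_sum)
  ultimately show ?thesis by blast
qed

section \<open>Permuting and rescaling variables\<close>

text \<open>Substitutes \<open>x\<^bsub>f i\<^esub>\<close> for \<open>x\<^sub>i\<close>, and then \<open>c x\<^sub>k\<close> for \<open>x\<^sub>k\<close>.\<close>

definition var_subst :: "(nat \<Rightarrow> nat) \<Rightarrow> nat \<Rightarrow> K \<Rightarrow> mpoly \<Rightarrow> mpoly" where
  "var_subst f k c g = Poly_Mapping.mapp (\<lambda>m v. c ^ lookup m k * v)
     (Poly_Mapping.map_key (Poly_Mapping.map_key f) g)"

lemma map_key_inv:
  assumes "bij f"
  shows "Poly_Mapping.map_key f (Poly_Mapping.map_key (inv f) m) = m"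
    and "Poly_Mapping.map_key (inv f) (Poly_Mapping.map_key f m') = m'"
  by (rule poly_mapping_eqI, simp add: map_key.rep_eq bij_is_inj bij_imp_bij_inv assms inv_f_f
      surj_f_inv_f bij_is_surj)+

lemma inj_map_key: "bij f \<Longrightarrow> inj (Poly_Mapping.map_key f :: ('a \<Rightarrow>\<^sub>0 'b::zero) \<Rightarrow> _)"
  by (rule inj_on_inverseI[of _ "Poly_Mapping.map_key (inv f)"]) (simp add: map_key_inv)

text \<open>\<open>map_key f m\<close> is the exponent vector \<open>m \<circ> f\<close>. The power
  of \<open>c\<close> is counted after the renaming, hence at index \<open>k\<close> of the
  resulting monomial.\<close>

lemma lookup_var_subst:
  assumes "bij f"
  shows "lookup (var_subst f k c g) m = c ^ lookup m k * lookup g (Poly_Mapping.map_key f m)"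
  unfolding var_subst_def lookup_mapp
  by (simp add: when_def in_keys_iff map_key.rep_eq inj_map_key assms)

lemma tdeg_map_key: "bij f \<Longrightarrow> tdeg (Poly_Mapping.map_key f m) = tdeg m"
  unfolding tdeg_def
  by (rule sum.reindex_bij_witness[of _ "inv f" f])
    (auto simp: keys_map_key bij_is_inj bij_is_surj map_key.rep_eq surj_f_inv_f)

lemma peval_var_subst:
  assumes f: "bij f"
  shows "peval (var_subst f k c g) x = peval g (\<lambda>i. (if f i = k then c else 1) * x (f i))"
proof -
  let ?mk = "Poly_Mapping.map_key (inv f) :: (nat \<Rightarrow>\<^sub>0 nat) \<Rightarrow> _"
  have f': "bij (inv f)" using f by (rule bij_imp_bij_inv)
  \<comment> \<open>The support of the substituted polynomial lies in the image of
    \<open>keys g\<close> under \<open>?mk\<close>; summation along \<open>?mk\<close> reduces the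
    claim to this identity for one monomial.\<close>
  have mon: "c ^ lookup (?mk m) k * mon_eval x (?mk m)
      = mon_eval (\<lambda>i. (if f i = k then c else 1) * x (f i)) m" for m
  proof -
    have "mon_eval x (?mk m) = (\<Prod>i\<in>keys m. x (f i) ^ lookup m i)"
      unfolding mon_eval_def
      by (rule prod.reindex_bij_witness[of _ f "inv f"])
        (auto simp: keys_map_key f' bij_is_inj bij_is_surj map_key.rep_eq surj_f_inv_f f)
    moreover have "(\<Prod>i\<in>keys m. (if f i = k then c else 1) ^ lookup m i) = c ^ lookup (?mk m) k"
    proof -
      have "(\<Prod>i\<in>keys m. (if f i = k then c else 1) ^ lookup m i)
          = (\<Prod>i\<in>keys m. if i = inv f k then c ^ lookup m i else 1)"
        by (rule prod.cong) (use f in \<open>auto simp: bij_is_inj bij_is_surj surj_f_inv_f\<close>)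
      also have "\<dots> = c ^ lookup m (inv f k)"
        by (simp add: in_keys_iff)
      finally show ?thesis using f' by (simp add: map_key.rep_eq bij_is_inj)
    qed
    ultimately show ?thesis
      by (simp add: mon_eval_def power_mult_distrib prod.distrib)
  qed
  have "keys (var_subst f k c g) \<subseteq> ?mk ` keys g"
  proof
    fix m assume "m \<in> keys (var_subst f k c g)"
    then have "Poly_Mapping.map_key f m \<in> keys g"
      by (auto simp: in_keys_iff lookup_var_subst f)
    then show "m \<in> ?mk ` keys g"
      by (metis image_eqI map_key_inv(2) f)
  qed
  then have "peval (var_subst f k c g) x
      = (\<Sum>m\<in>?mk ` keys g. lookup (var_subst f k c g) m * mon_eval x m)"
    by (intro peval_superset) auto
  also have "\<dots> = (\<Sum>m\<in>keys g. lookup g m * (c ^ lookup (?mk m) k * mon_eval x (?mk m)))"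
    by (subst sum.reindex)
      (auto simp: lookup_var_subst f map_key_inv mult_ac intro!: inj_on_subset[OF inj_map_key[OF f']])
  also have "\<dots> = peval g (\<lambda>i. (if f i = k then c else 1) * x (f i))"
    unfolding mon by (simp add: peval_superset[of "keys g"])
  finally show ?thesis .
qed

lemma poly_in_var_subst:
  assumes f: "bij f" and g: "poly_in A d g"
  shows "poly_in (f ` A) d (var_subst f k c g)"
  unfolding poly_in_def
proof (intro allI impI)
  fix m assume "lookup (var_subst f k c g) m \<noteq> 0"
  then have "lookup g (Poly_Mapping.map_key f m) \<noteq> 0" by (simp add: lookup_var_subst f)
  then have "keys (Poly_Mapping.map_key f m) \<subseteq> A" "tdeg (Poly_Mapping.map_key f m) < d"
    using g by (auto simp: poly_in_def)
  then show "keys m \<subseteq> f ` A \<and> tdeg m < d"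
    using f image_mono[of "f -` keys m" A f]
    by (simp add: tdeg_map_key keys_map_key bij_is_inj surj_image_vimage_eq bij_is_surj)
qed

text \<open>The scaling factor \<open>1\<close> makes the index \<open>0\<close> a mere
  placeholder.\<close>

lemma swap_poly_eq: "swap_poly i g = var_subst (Transposition.transpose i (Suc i)) 0 1 g"
proof -
  let ?s = "Transposition.transpose i (Suc i)"
  have s: "inj ?s" by simp
  have "Abs_poly_mapping (lookup m \<circ> ?s) = Poly_Mapping.map_key ?s m" for m :: "nat \<Rightarrow>\<^sub>0 nat"
    by (simp add: map_key.rep_eq[OF s, symmetric] lookup_inverse)
  then have "swap_poly i g = Abs_poly_mapping (lookup (var_subst ?s 0 1 g))"
    unfolding swap_poly_def by (intro arg_cong[where f = Abs_poly_mapping] ext) (simp add: lookup_var_subst)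
  then show ?thesis by (simp add: lookup_inverse)
qed

lemma peval_swap_poly: "peval (swap_poly i g) x = peval g (x \<circ> Transposition.transpose i (Suc i))"
  unfolding swap_poly_eq by (subst peval_var_subst) (simp_all add: o_def)

lemma lookup_swap_poly:
  "lookup (swap_poly i g) m = lookup g (Poly_Mapping.map_key (Transposition.transpose i (Suc i)) m)"
  by (simp add: swap_poly_eq lookup_var_subst)

section \<open>The operators \<open>T\<^sub>i\<close>\<close>

text \<open>Factoring out the smaller exponent from both products leaves
  \<open>x ^ d - y ^ d\<close> up to sign.\<close>

lemma diff_dvd_swapped_powers:
  fixes x y :: "'a::comm_ring_1"
  shows "x - y dvd x ^ r * y ^ s - x ^ s * y ^ r"
proof -
  have pow: "x - y dvd x ^ d - y ^ d" for d
    by (metis dvd_triv_left power_diff_sumr2)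
  show ?thesis
  proof (cases r s rule: le_cases)
    case le
    then obtain d where "s = r + d" using le_Suc_ex by blast
    then have "x ^ r * y ^ s - x ^ s * y ^ r = (x ^ d - y ^ d) * (- (x ^ r * y ^ r))"
      by (simp add: algebra_simps power_add)
    then show ?thesis using pow by (metis dvd_mult2)
  next
    case ge
    then obtain d where "r = s + d" using le_Suc_ex by blast
    then have "x ^ r * y ^ s - x ^ s * y ^ r = (x ^ d - y ^ d) * (x ^ s * y ^ s)"
      by (simp add: algebra_simps power_add)
    then show ?thesis using pow by (metis dvd_mult2)
  qed
qed

lemma Xv_power: "Xv i ^ r = single (single i r) 1"
  by (induction r) (simp_all add: Xv_def mult_single flip: single_add)

text \<open>By linearity one monomial suffices; splitting off its powers of the two variables leaves
  a difference of swapped powers.\<close>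

lemma diff_dvd_diff_swap_poly: "Xv i - Xv (Suc i) dvd g - swap_poly i g"
proof -
  let ?s = "Transposition.transpose i (Suc i)"
  have mon: "Xv i - Xv (Suc i) dvd single m v - swap_poly i (single m v)" for m v
  proof -
    define r where "r = lookup m i"
    define s where "s = lookup m (Suc i)"
    define m0 where "m0 = m - single i r - single (Suc i) s"
    have m: "m = m0 + single i r + single (Suc i) s"
      unfolding m0_def
      by (rule poly_mapping_eqI) (auto simp: lookup_add lookup_minus lookup_single when_def r_def s_def)
    have m0: "lookup m0 i = 0" "lookup m0 (Suc i) = 0"
      by (auto simp: m0_def lookup_minus lookup_single r_def s_def)
    have sm: "Poly_Mapping.map_key ?s k = m \<longleftrightarrow> k = m0 + single i s + single (Suc i) r" for k
    proof -
      have "Poly_Mapping.map_key ?s k = m \<longleftrightarrow> k = Poly_Mapping.map_key ?s m"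
        using map_key_inv[of ?s] by (metis bij_transpose inv_transpose_eq)
      also have "Poly_Mapping.map_key ?s m = m0 + single i s + single (Suc i) r"
        by (subst m, rule poly_mapping_eqI)
          (use m0 in \<open>auto simp: map_key.rep_eq lookup_add lookup_single when_def Transposition.transpose_def\<close>)
      finally show ?thesis .
    qed
    have "swap_poly i (single m v) = single (m0 + single i s + single (Suc i) r) v"
      by (rule poly_mapping_eqI)
        (auto simp: lookup_swap_poly lookup_single when_def sm eq_commute[of m] eq_commute[of "m0 + _ + _"])
    also have "\<dots> = single m0 v * (Xv i ^ s * Xv (Suc i) ^ r)"
      by (simp add: Xv_power mult_single add_ac)
    finally have "single m v - swap_poly i (single m v) =
        single m0 v * (Xv i ^ r * Xv (Suc i) ^ s - Xv i ^ s * Xv (Suc i) ^ r)"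
      by (subst m) (simp add: Xv_power mult_single add_ac right_diff_distrib)
    then show ?thesis using diff_dvd_swapped_powers by (metis dvd_mult)
  qed
  have "swap_poly i g = (\<Sum>m\<in>keys g. swap_poly i (single m (lookup g m)))"
  proof (rule poly_mapping_eqI)
    fix m
    have "lookup (\<Sum>k\<in>keys g. swap_poly i (single k (lookup g k))) m
        = lookup (\<Sum>k\<in>keys g. single k (lookup g k)) (Poly_Mapping.map_key ?s m)"
      unfolding lookup_sum lookup_swap_poly ..
    then show "lookup (swap_poly i g) m = lookup (\<Sum>k\<in>keys g. swap_poly i (single k (lookup g k))) m"
      by (simp add: poly_mapping_sum_single lookup_swap_poly)
  qed
  then have "g - swap_poly i g = (\<Sum>m\<in>keys g. single m (lookup g m) - swap_poly i (single m (lookup g m)))"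
    by (simp add: sum_subtractf poly_mapping_sum_single)
  then show ?thesis using mon by (simp add: dvd_sum)
qed

lemma Xv_diff_nonzero: "Xv i - Xv (Suc i) \<noteq> 0"
proof
  assume "Xv i - Xv (Suc i) = 0"
  then have "peval (Xv i - Xv (Suc i)) (\<lambda>k. if k = i then 1 else 0) = 0" by simp
  then show False by (simp add: peval_minus)
qed

text \<open>Divisibility gives existence and cancellation of the nonzero factor gives uniqueness, so
  the \<open>THE\<close> in \<open>Top\<close> is meaningful. Substituting
  \<open>g = s_i g + (x_i - x_{i+1}) D\<close> into the definition cancels the terms with
  \<open>x_i D\<close> up to a single one with \<open>x_{i+1} D\<close>.\<close>

lemma Top_quotient:
  obtains D where "g - swap_poly i g = (Xv i - Xv (Suc i)) * D"
    and "Top i g = Cst tt * swap_poly i g + Cst (1 - tt) * (Xv (Suc i) * D)"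
proof -
  obtain D where D: "g - swap_poly i g = (Xv i - Xv (Suc i)) * D"
    using diff_dvd_diff_swap_poly by (metis dvdE)
  let ?h = "Cst tt * g - (Cst tt * Xv i - Xv (Suc i)) * D"
  have "Top i g = ?h"
    unfolding Top_def
  proof (rule the_equality)
    show *: "?h * (Xv i - Xv (Suc i)) = Cst tt * g * (Xv i - Xv (Suc i)) -
        (Cst tt * Xv i - Xv (Suc i)) * (g - swap_poly i g)"
      unfolding D by (simp add: algebra_simps)
    fix h assume "h * (Xv i - Xv (Suc i)) = Cst tt * g * (Xv i - Xv (Suc i)) -
        (Cst tt * Xv i - Xv (Suc i)) * (g - swap_poly i g)"
    then have "h * (Xv i - Xv (Suc i)) = ?h * (Xv i - Xv (Suc i))" using * by simp
    then show "h = ?h" using Xv_diff_nonzero[of i] by simp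
  qed
  moreover have "Cst tt * g = Cst tt * (swap_poly i g + (Xv i - Xv (Suc i)) * D)"
    by (simp flip: D)
  moreover have "Cst (1 - tt) = 1 - Cst tt"
    by (simp add: Cst_def single_diff)
  ultimately have "Top i g = Cst tt * swap_poly i g + Cst (1 - tt) * (Xv (Suc i) * D)"
    by (simp only:) (simp add: algebra_simps)
  with D show ?thesis by (rule that)
qed

text \<open>Stated without division, so that it holds at every point, also where the two coordinates
  agree.\<close>

lemma peval_Top:
  "peval (Top i g) x * (x i - x (Suc i)) = tt * peval g x * (x i - x (Suc i)) -
     (tt * x i - x (Suc i)) * (peval g x - peval g (x \<circ> Transposition.transpose i (Suc i)))"
proof -
  obtain D where D: "g - swap_poly i g = (Xv i - Xv (Suc i)) * D"
    and T: "Top i g = Cst tt * swap_poly i g + Cst (1 - tt) * (Xv (Suc i) * D)"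
    by (rule Top_quotient)
  let ?y = "x \<circ> Transposition.transpose i (Suc i)"
  have "peval g x - peval g ?y = (x i - x (Suc i)) * peval D x"
    using arg_cong[OF D, of "\<lambda>p. peval p x"] by (simp add: peval_minus peval_mult peval_swap_poly)
  then have g: "peval g x = peval g ?y + (x i - x (Suc i)) * peval D x"
    by (simp add: algebra_simps)
  have T': "peval (Top i g) x = tt * peval g ?y + (1 - tt) * (x (Suc i) * peval D x)"
    unfolding T by (simp add: peval_add peval_mult peval_swap_poly)
  show ?thesis unfolding g T' by (simp add: algebra_simps)
qed

section \<open>Coefficients of \<open>Top i g\<close>\<close>

lemma coeffx_lookup [simp]: "coeffx g (lookup m) = lookup g m"
  by (simp add: coeffx_def lookup_inverse)

text \<open>On a line of monomials in which only the exponents \<open>a\<close>, \<open>b\<close> of \<open>x\<^sub>i\<close>, \<open>x\<^bsub>i+1\<^esub>\<close> vary,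
  the quotient \<open>D = (g - s\<^sub>i g) / (x\<^sub>i - x\<^bsub>i+1\<^esub>)\<close> has telescoping coefficients, which can be summed
  from either end of the line.\<close>

lemma coeffx_Top:
  assumes fin: "finite {x. \<mu> x \<noteq> 0}"
  shows "coeffx (Top i g) \<mu> = tt * coeffx g (\<mu>(i := \<mu> (Suc i), Suc i := \<mu> i)) +
    (1 - tt) * (\<Sum>j \<in> (if \<mu> i < \<mu> (Suc i) then {..\<mu> i} else {..<\<mu> (Suc i)}).
       coeffx g (\<mu>(i := \<mu> i + \<mu> (Suc i) - j, Suc i := j))
     - coeffx g (\<mu>(i := j, Suc i := \<mu> i + \<mu> (Suc i) - j)))"
proof -
  define m0 where "m0 = Abs_poly_mapping (\<mu>(i := 0, Suc i := 0))"
  define L where "L a b = m0 + single i a + single (Suc i) b" for a b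
  have fin': "finite {x. (\<mu>(i := a, Suc i := b)) x \<noteq> 0}" for a b
    by (rule finite_subset[of _ "{x. \<mu> x \<noteq> 0} \<union> {i, Suc i}"]) (use fin in auto)
  have m0: "lookup m0 = \<mu>(i := 0, Suc i := 0)"
    unfolding m0_def by (simp only: lookup_Abs_poly_mapping[OF fin'])
  have L: "lookup (L a b) = \<mu>(i := a, Suc i := b)" for a b
    by (rule ext) (auto simp: L_def lookup_add m0 lookup_single when_def)
  have cL: "coeffx g (\<mu>(i := a, Suc i := b)) = lookup g (L a b)" for g a b
    by (metis L coeffx_lookup)
  have LSuc: "L (Suc a) b = single i 1 + L a b" "L a (Suc b) = single (Suc i) 1 + L a b" for a b
    by (rule poly_mapping_eqI; simp add: lookup_add lookup_single when_def L)+
  have swap: "lookup (swap_poly i g) (L a b) = lookup g (L b a)" for a b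
    unfolding lookup_swap_poly
    by (rule arg_cong[where f = "lookup g"], rule poly_mapping_eqI)
      (auto simp: map_key.rep_eq L Transposition.transpose_def)
  obtain D where D: "g - swap_poly i g = (Xv i - Xv (Suc i)) * D"
    and T: "Top i g = Cst tt * swap_poly i g + Cst (1 - tt) * (Xv (Suc i) * D)"
    by (rule Top_quotient)
  define E where "E a b = lookup g (L a b) - lookup g (L b a)" for a b
  have ED: "E a b = lookup (Xv i * D) (L a b) - lookup (Xv (Suc i) * D) (L a b)" for a b
    using arg_cong[OF D, of "\<lambda>p. lookup p (L a b)"]
    by (simp add: E_def lookup_minus swap left_diff_distrib)
  have zero: "lookup (Xv i * D) (L 0 b) = 0" "lookup (Xv (Suc i) * D) (L a 0) = 0" for a b
    by (simp_all add: lookup_Xv_mult_0 L)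
  have mult: "lookup (Xv i * D) (L (Suc a) b) = lookup D (L a b)"
    "lookup (Xv (Suc i) * D) (L a (Suc b)) = lookup D (L a b)" for a b
    unfolding LSuc by (simp_all only: lookup_Xv_mult)
  have D_right: "lookup D (L a b) = (\<Sum>j\<le>b. E (a + b + 1 - j) j)" for a b
  proof (induction b arbitrary: a)
    case 0
    then show ?case using ED[of "Suc a" 0] by (simp add: mult zero)
  next
    case (Suc b)
    then show ?case using ED[of "Suc a" "Suc b"] Suc[of "Suc a"] by (simp add: mult)
  qed
  have D_left: "lookup D (L a b) = (\<Sum>j\<le>a. E (a + b + 1 - j) j)" for a b
  proof (induction a arbitrary: b)
    case 0
    then show ?case using ED[of 0 "Suc b"] by (simp add: mult zero E_def)
  next
    case (Suc a)
    then show ?case using ED[of "Suc a" "Suc b"] Suc[of "Suc b"] by (simp add: mult E_def)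
  qed
  \<comment> \<open>Multiplication by the second variable shifts \<open>b\<close> by one. The end of
    the line is chosen so that \<open>j\<close> exceeds neither \<open>a\<close> nor
    \<open>b\<close>: only exponent pairs at least as spread out as \<open>a\<close>,
    \<open>b\<close> enter.\<close>
  have XD: "lookup (Xv (Suc i) * D) (L a b) =
      (\<Sum>j\<in>(if a < b then {..a} else {..<b}). E (a + b - j) j)" for a b
  proof (cases b)
    case 0
    then show ?thesis by (simp add: zero)
  next
    case (Suc b')
    then show ?thesis
      using D_left[of a b'] D_right[of a b'] by (simp add: mult lessThan_Suc_atMost)
  qed
  let ?a = "\<mu> i" and ?b = "\<mu> (Suc i)"
  have "coeffx (Top i g) \<mu> = coeffx (Top i g) (\<mu>(i := ?a, Suc i := ?b))" by simp
  also have "\<dots> = tt * lookup g (L ?b ?a) + (1 - tt) * lookup (Xv (Suc i) * D) (L ?a ?b)"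
    unfolding cL T by (simp add: lookup_add swap)
  finally show ?thesis unfolding XD E_def cL .
qed

text \<open>Every coefficient of \<open>g\<close> that occurs in \<open>coeffx_Top\<close> belongs
  to a pair of exponents with the same sum and at least the same maximum. This is the source of the
  compatibility of \<open>Top\<close> with dominance.\<close>

lemma coeffx_Top_nonzero:
  assumes fin: "finite {x. \<mu> x \<noteq> 0}" and nz: "coeffx (Top i g) \<mu> \<noteq> 0"
  obtains a b where "a + b = \<mu> i + \<mu> (Suc i)" "max (\<mu> i) (\<mu> (Suc i)) \<le> max a b"
    "coeffx g (\<mu>(i := a, Suc i := b)) \<noteq> 0"
proof (rule ccontr)
  assume "\<not> thesis"
  note found = that
  have no: "coeffx g (\<mu>(i := a, Suc i := b)) = 0"
    if "a + b = \<mu> i + \<mu> (Suc i)" "max (\<mu> i) (\<mu> (Suc i)) \<le> max a b" for a b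
    using that found \<open>\<not> thesis\<close> by blast
  have "coeffx g (\<mu>(i := \<mu> (Suc i), Suc i := \<mu> i)) = 0"
    by (rule no) auto
  moreover have "coeffx g (\<mu>(i := \<mu> i + \<mu> (Suc i) - j, Suc i := j))
     - coeffx g (\<mu>(i := j, Suc i := \<mu> i + \<mu> (Suc i) - j)) = 0"
    if "j \<in> (if \<mu> i < \<mu> (Suc i) then {..\<mu> i} else {..<\<mu> (Suc i)})" for j
  proof -
    have j: "j \<le> \<mu> i" "j \<le> \<mu> (Suc i)" using that by (auto split: if_splits)
    have "coeffx g (\<mu>(i := \<mu> i + \<mu> (Suc i) - j, Suc i := j)) = 0"
      "coeffx g (\<mu>(i := j, Suc i := \<mu> i + \<mu> (Suc i) - j)) = 0"
      by (rule no; use j in linarith)+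
    then show ?thesis by simp
  qed
  ultimately have "coeffx (Top i g) \<mu> = 0"
    unfolding coeffx_Top[OF fin] by (subst sum.neutral) auto
  with nz show False by simp
qed

text \<open>A monomial of \<open>Top i g\<close> is traced back to one of \<open>g\<close> that
  differs only in the two exponents, whose sum is unchanged.\<close>

lemma poly_in_Top:
  assumes g: "poly_in A d g" and iA: "i \<in> A" "Suc i \<in> A"
  shows "poly_in A d (Top i g)"
  unfolding poly_in_def
proof (intro allI impI)
  fix m assume "lookup (Top i g) m \<noteq> 0"
  then obtain a b where ab: "a + b = lookup m i + lookup m (Suc i)"
    "coeffx g ((lookup m)(i := a, Suc i := b)) \<noteq> 0"
    using coeffx_Top_nonzero[of "lookup m" i g] by (metis coeffx_lookup finite_lookup)
  define m' where "m' = Abs_poly_mapping ((lookup m)(i := a, Suc i := b))"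
  have "finite {x. ((lookup m)(i := a, Suc i := b)) x \<noteq> 0}"
    by (rule finite_subset[of _ "{x. lookup m x \<noteq> 0} \<union> {i, Suc i}"]) auto
  then have m': "lookup m' = (lookup m)(i := a, Suc i := b)"
    unfolding m'_def by (rule lookup_Abs_poly_mapping)
  have "lookup g m' \<noteq> 0" using ab(2) by (simp flip: m')
  then have A: "keys m' \<subseteq> A" "tdeg m' < d" using g by (auto simp: poly_in_def)
  let ?B = "keys m \<union> keys m' \<union> {i, Suc i}"
  have B: "?B = insert i (insert (Suc i) (?B - {i, Suc i}))" by auto
  have fB: "finite (?B - {i, Suc i})" by simp
  have "(\<Sum>x\<in>?B. lookup m x) = (\<Sum>x\<in>?B. lookup m' x)"
    by (subst (1 2) B) (use fB ab(1) in \<open>simp add: m'\<close>)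
  then have "tdeg m = tdeg m'"
    by (subst (1 2) tdeg_superset[of ?B]) auto
  moreover have "keys m \<subseteq> A"
  proof
    fix x assume "x \<in> keys m"
    then have "x \<in> keys m' \<or> x = i \<or> x = Suc i" by (auto simp: in_keys_iff m')
    then show "x \<in> A" using A iA by auto
  qed
  ultimately show "keys m \<subseteq> A \<and> tdeg m < d" using A by simp
qed

section \<open>Dominance\<close>

text \<open>For compositions of equal size, pointwise comparison of the functions
  \<open>a \<mapsto> \<Sum>\<^sub>j max (\<mu>\<^sub>j - a) 0\<close> is the dominance order on the underlying partitions, and equality of these
  functions means that the compositions are rearrangements of each other. Here the subtraction is the
  truncated one.\<close>

definition profile :: "nat \<Rightarrow> (nat \<Rightarrow> nat) \<Rightarrow> nat \<Rightarrow> nat" where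
  "profile n \<mu> a = (\<Sum>j<n. \<mu> j - a)"

lemma profile_0: "profile n \<mu> 0 = csize n \<mu>"
  by (simp add: profile_def csize_def)

lemma profile_upd:
  assumes "Suc i < n"
  shows "profile n (\<mu>(i := a, Suc i := b)) x = (\<Sum>j\<in>{..<n} - {i, Suc i}. \<mu> j - x) + (a - x) + (b - x)"
proof -
  have "{..<n} = insert i (insert (Suc i) ({..<n} - {i, Suc i}))" using assms by auto
  then have "profile n (\<mu>(i := a, Suc i := b)) x
     = (\<Sum>j\<in>insert i (insert (Suc i) ({..<n} - {i, Suc i})). (\<mu>(i := a, Suc i := b)) j - x)"
    unfolding profile_def by metis
  then show ?thesis by simp
qed

text \<open>Spreading two numbers with fixed sum increases the sum of the values of a convex
  function, here truncated subtraction of \<open>x\<close>.\<close>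

lemma profile_upd_mono:
  assumes "Suc i < n" "a + b = \<mu> i + \<mu> (Suc i)" "max (\<mu> i) (\<mu> (Suc i)) \<le> max a b"
  shows "profile n \<mu> x \<le> profile n (\<mu>(i := a, Suc i := b)) x"
  using profile_upd[OF assms(1), of \<mu> "\<mu> i" "\<mu> (Suc i)" x] profile_upd[OF assms(1), of \<mu> a b x] assms(2,3)
  by (auto simp: max_def split: if_splits)

text \<open>At the old maximum both old terms are truncated to zero, while the larger new one is
  positive.\<close>

lemma profile_upd_strict:
  assumes "Suc i < n" "a + b = \<mu> i + \<mu> (Suc i)" "max (\<mu> i) (\<mu> (Suc i)) < max a b"
  shows "profile n \<mu> (max (\<mu> i) (\<mu> (Suc i))) < profile n (\<mu>(i := a, Suc i := b)) (max (\<mu> i) (\<mu> (Suc i)))"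
  using profile_upd[OF assms(1), of \<mu> "\<mu> i" "\<mu> (Suc i)"] profile_upd[OF assms(1), of \<mu> a b] assms(2,3)
  by (auto simp: max_def split: if_splits)

definition top_dominated :: "nat \<Rightarrow> mpoly \<Rightarrow> (nat \<Rightarrow> nat) \<Rightarrow> bool" where
  "top_dominated n g lam \<longleftrightarrow> (\<forall>\<nu>. is_comp n \<nu> \<and> csize n \<nu> = csize n lam \<and> coeffx g \<nu> \<noteq> 0 \<longrightarrow>
     (\<forall>a. profile n \<nu> a \<le> profile n lam a))"

lemma is_comp_finite: "is_comp n \<mu> \<Longrightarrow> finite {x. \<mu> x \<noteq> 0}"
  by (rule finite_subset[of _ "{..<n}"]) (auto simp: is_comp_def not_less[symmetric])

lemma is_comp_upd: "is_comp n \<mu> \<Longrightarrow> Suc i < n \<Longrightarrow> is_comp n (\<mu>(i := a, Suc i := b))"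
  by (auto simp: is_comp_def)

lemma csize_upd:
  assumes "Suc i < n" "a + b = \<mu> i + \<mu> (Suc i)"
  shows "csize n (\<mu>(i := a, Suc i := b)) = csize n \<mu>"
  using profile_upd[OF assms(1), of \<mu> a b 0] profile_upd[OF assms(1), of \<mu> "\<mu> i" "\<mu> (Suc i)" 0] assms(2)
  by (simp add: profile_0)

lemma top_dominated_Top:
  assumes g: "top_dominated n g lam" and i: "Suc i < n"
  shows "top_dominated n (Top i g) lam"
  unfolding top_dominated_def
proof (intro allI impI, elim conjE)
  fix \<nu> x assume \<nu>: "is_comp n \<nu>" "csize n \<nu> = csize n lam" "coeffx (Top i g) \<nu> \<noteq> 0"
  then obtain a b where ab: "a + b = \<nu> i + \<nu> (Suc i)" "max (\<nu> i) (\<nu> (Suc i)) \<le> max a b"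
    "coeffx g (\<nu>(i := a, Suc i := b)) \<noteq> 0"
    using coeffx_Top_nonzero is_comp_finite by metis
  then have "profile n (\<nu>(i := a, Suc i := b)) x \<le> profile n lam x"
    using g \<nu> i by (simp add: top_dominated_def is_comp_upd csize_upd)
  then show "profile n \<nu> x \<le> profile n lam x"
    using profile_upd_mono[OF i ab(1,2), of x] by simp
qed

text \<open>For \<open>\<mu>\<close> with the profile of \<open>lam\<close>, dominance kills every
  term of \<open>coeffx_Top\<close> whose maximal exponent is strictly larger. Only
  \<open>\<mu>\<close> and its swap remain, the former only at an ascent, where
  \<open>t c' + (1 - t) (c' - c) = c' + (t - 1) c\<close>.\<close>

lemma coeffx_Top_orbit:
  assumes g: "top_dominated n g lam" and i: "Suc i < n" and \<mu>: "is_comp n \<mu>" "profile n \<mu> = profile n lam"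
  shows "coeffx (Top i g) \<mu> = (if \<mu> i < \<mu> (Suc i)
     then coeffx g (\<mu> \<circ> Transposition.transpose i (Suc i)) + (tt - 1) * coeffx g \<mu>
     else tt * coeffx g (\<mu> \<circ> Transposition.transpose i (Suc i)))"
proof -
  let ?a = "\<mu> i" and ?b = "\<mu> (Suc i)"
  have sw: "\<mu> \<circ> Transposition.transpose i (Suc i) = \<mu>(i := ?b, Suc i := ?a)"
    by (auto simp: Transposition.transpose_def)
  have size: "csize n \<mu> = csize n lam" using \<mu>(2) by (simp flip: profile_0)
  have zero: "coeffx g (\<mu>(i := a, Suc i := b)) = 0" if "a + b = ?a + ?b" "max ?a ?b < max a b" for a b
    using profile_upd_strict[OF i that] g \<mu> that i size
    unfolding top_dominated_def by (metis csize_upd is_comp_upd not_le)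
  show ?thesis
  proof (cases "?a < ?b")
    case True
    have "(\<Sum>j\<le>?a. coeffx g (\<mu>(i := ?a + ?b - j, Suc i := j)) - coeffx g (\<mu>(i := j, Suc i := ?a + ?b - j)))
       = (\<Sum>j\<le>?a. if j = ?a then coeffx g (\<mu>(i := ?b, Suc i := ?a)) - coeffx g \<mu> else 0)"
      by (rule sum.cong) (use True in \<open>auto simp: zero\<close>)
    also have "\<dots> = coeffx g (\<mu>(i := ?b, Suc i := ?a)) - coeffx g \<mu>" by simp
    finally have "coeffx (Top i g) \<mu> = tt * coeffx g (\<mu>(i := ?b, Suc i := ?a)) +
        (1 - tt) * (coeffx g (\<mu>(i := ?b, Suc i := ?a)) - coeffx g \<mu>)"
      unfolding coeffx_Top[OF is_comp_finite[OF \<mu>(1)]] using True by (simp only: if_True)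
    then show ?thesis using True unfolding sw by (simp add: algebra_simps)
  next
    case False
    have "(\<Sum>j<?b. coeffx g (\<mu>(i := ?a + ?b - j, Suc i := j)) - coeffx g (\<mu>(i := j, Suc i := ?a + ?b - j))) = 0"
      by (rule sum.neutral) (use False in \<open>auto simp: zero\<close>)
    then show ?thesis
      using False unfolding sw coeffx_Top[OF is_comp_finite[OF \<mu>(1)]] by simp
  qed
qed

section \<open>The interpolation nodes\<close>

lemma qq_power: "qq ^ a = Fract (monom 1 a) 1"
proof (induction a)
  case 0
  then show ?case by (simp add: One_fract_def monom_0 one_pCons)
next
  case (Suc a)
  then show ?case by (simp add: qq_def monom_Suc)
qed

lemma tt_power: "tt ^ a = Fract [:monom 1 a:] 1"
proof (induction a)
  case 0
  then show ?case by (simp add: One_fract_def monom_0 one_pCons)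
next
  case (Suc a)
  then show ?case by (simp add: tt_def monom_Suc)
qed

text \<open>Both sides are monomials in two independent variables. Hence coordinates of nodes can be
  compared exponent by exponent.\<close>

lemma qq_tt_power_eq_iff: "qq ^ a * tt ^ l = qq ^ b * tt ^ k \<longleftrightarrow> a = b \<and> l = k"
proof -
  have "qq ^ a * tt ^ l = Fract (monom (monom 1 l) a) 1" for a l
    by (simp add: qq_power tt_power mult.commute[of _ "[:_:]"] smult_monom)
  then show ?thesis
    by (auto simp: eq_fract monom_eq_iff' )
qed

lemma qq_nonzero [simp]: "qq \<noteq> 0"
  using qq_tt_power_eq_iff[of 1 0 2 0] by auto

lemma tt_nonzero [simp]: "tt \<noteq> 0"
  using qq_tt_power_eq_iff[of 0 1 0 2] by auto

lemma tilde_eqD: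
  assumes "tilde n \<mu> i = tilde n \<nu> j" "i < n" "j < n"
  shows "\<mu> i = \<nu> j" "kk n \<mu> i = kk n \<nu> j"
proof -
  have "qq ^ \<mu> i * tt ^ kk n \<nu> j = qq ^ \<nu> j * tt ^ kk n \<mu> i"
    using assms by (simp add: tilde_def frac_eq_eq)
  then show "\<mu> i = \<nu> j" "kk n \<mu> i = kk n \<nu> j"
    by (auto simp: qq_tt_power_eq_iff)
qed

text \<open>The strict total order of positions by decreasing parts, with equal parts taken from
  right to left; \<open>kk\<close> is the rank in this order, counted from zero.\<close>

definition precedes :: "(nat \<Rightarrow> nat) \<Rightarrow> nat \<Rightarrow> nat \<Rightarrow> bool" where
  "precedes \<mu> j i \<longleftrightarrow> (j < i \<and> \<mu> j > \<mu> i) \<or> (i < j \<and> \<mu> j \<ge> \<mu> i)"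

lemma kk_precedes: "i < n \<Longrightarrow> kk n \<mu> i = card {j. j < n \<and> precedes \<mu> j i}"
  unfolding kk_def
  by (subst card_Un_disjoint[symmetric]) (auto simp: precedes_def intro!: arg_cong[where f = card])

lemma kk_permute:
  assumes f: "f permutes {..<n}" and i: "i < n"
    and prec: "\<And>j. j < n \<Longrightarrow> precedes \<nu> (f j) (f i) \<longleftrightarrow> precedes \<mu> j i"
  shows "kk n \<nu> (f i) = kk n \<mu> i"
proof -
  have fn: "f j < n \<longleftrightarrow> j < n" for j using permutes_in_image[OF f, of j] by simp
  have "f ` {j. j < n \<and> precedes \<mu> j i} = {j. j < n \<and> precedes \<nu> j (f i)}"
  proof safe
    fix j assume j: "j < n" "precedes \<nu> j (f i)"
    then obtain j' where "j = f j'" using permutes_surj[OF f] by (metis surjD)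
    then show "j \<in> f ` {j. j < n \<and> precedes \<mu> j i}" using j fn prec by auto
  qed (use fn prec in auto)
  then show ?thesis
    using i fn card_image[OF inj_on_subset[OF permutes_inj[OF f]], of "{j. j < n \<and> precedes \<mu> j i}"]
    by (simp add: kk_precedes)
qed

lemma transpose_permutes: "Suc i < n \<Longrightarrow> Transposition.transpose i (Suc i) permutes {..<n}"
  by (rule permutes_swap_id) auto

text \<open>Exchanging adjacent unequal parts affects no tie-break, so each rank moves along with
  its part.\<close>

lemma tilde_transpose:
  assumes "Suc i < n" "\<nu> i \<noteq> \<nu> (Suc i)"
  shows "tilde n (\<nu> \<circ> Transposition.transpose i (Suc i)) = tilde n \<nu> \<circ> Transposition.transpose i (Suc i)"
proof
  let ?s = "Transposition.transpose i (Suc i)"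
  have kk: "kk n (\<nu> \<circ> ?s) (?s j) = kk n \<nu> j" if "j < n" for j
  proof (rule kk_permute[OF transpose_permutes[OF assms(1)] that])
    fix l
    show "precedes (\<nu> \<circ> ?s) (?s l) (?s j) \<longleftrightarrow> precedes \<nu> l j"
      using assms by (cases "l = i"; cases "l = Suc i"; cases "j = i"; cases "j = Suc i")
        (auto simp: precedes_def)
  qed
  have s: "?s j < n \<longleftrightarrow> j < n" for j
    using assms by (auto simp: Transposition.transpose_def)
  fix j
  have "tilde n (\<nu> \<circ> ?s) j = tilde n (\<nu> \<circ> ?s) (?s (?s j))" by simp
  also have "\<dots> = tilde n \<nu> (?s j)"
    using kk[of "?s j"] s by (simp add: tilde_def)
  finally show "tilde n (\<nu> \<circ> ?s) j = (tilde n \<nu> \<circ> ?s) j" by simp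
qed

text \<open>Adjacent equal parts are consecutive in the order, the right one first. Hence at such a
  node \<open>t x_i - x_{i+1}\<close> vanishes.\<close>

lemma kk_equal_parts:
  assumes "Suc i < n" "\<nu> i = \<nu> (Suc i)"
  shows "kk n \<nu> i = Suc (kk n \<nu> (Suc i))"
proof -
  have "{j. j < n \<and> precedes \<nu> j i} = insert (Suc i) {j. j < n \<and> precedes \<nu> j (Suc i)}"
    using assms by (auto simp: precedes_def less_Suc_eq)
  moreover have "Suc i \<notin> {j. j < n \<and> precedes \<nu> j (Suc i)}" by (simp add: precedes_def)
  ultimately show ?thesis using assms by (simp add: kk_precedes)
qed

lemma tilde_equal_parts:
  "Suc i < n \<Longrightarrow> \<nu> i = \<nu> (Suc i) \<Longrightarrow> tt * tilde n \<nu> i = tilde n \<nu> (Suc i)"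
  by (simp add: tilde_def kk_equal_parts)

lemma tilde_adjacent_neq: "Suc i < n \<Longrightarrow> tilde n \<nu> i \<noteq> tilde n \<nu> (Suc i)"
  using tilde_eqD[of n \<nu> i \<nu> "Suc i"] kk_equal_parts[of i n \<nu>] by auto

text \<open>Either the swapped point is again a node, or the parts are equal and the factor
  \<open>t x_i - x_{i+1}\<close> in \<open>peval_Top\<close> removes the value at the swapped
  point.\<close>

lemma peval_Top_tilde_zero:
  assumes i: "Suc i < n" and g: "peval g (tilde n \<nu>) = 0"
    and gs: "\<nu> i \<noteq> \<nu> (Suc i) \<Longrightarrow> peval g (tilde n (\<nu> \<circ> Transposition.transpose i (Suc i))) = 0"
  shows "peval (Top i g) (tilde n \<nu>) = 0"
proof -
  have "(tt * tilde n \<nu> i - tilde n \<nu> (Suc i)) *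
      peval g (tilde n \<nu> \<circ> Transposition.transpose i (Suc i)) = 0"
    using gs tilde_transpose[OF i, of \<nu>] tilde_equal_parts[OF i, of \<nu>] by auto
  then have "peval (Top i g) (tilde n \<nu>) * (tilde n \<nu> i - tilde n \<nu> (Suc i)) = 0"
    unfolding peval_Top by (simp add: g)
  then show ?thesis using tilde_adjacent_neq[OF i] by simp
qed

section \<open>Raising compositions\<close>

text \<open>The cyclic shift of the positions from \<open>k\<close> to \<open>n - 1\<close>, fixing
  all others.\<close>

definition rot :: "nat \<Rightarrow> nat \<Rightarrow> nat \<Rightarrow> nat" where
  "rot n k i = (if k \<le> i \<and> Suc i < n then Suc i else if k \<le> i \<and> Suc i = n then k else i)"

text \<open>For \<open>k = 0\<close> this is the raising map \<Phi>; larger \<open>k\<close> serve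
  the variables left over after the first \<open>k\<close> have been eliminated.\<close>

definition raise :: "nat \<Rightarrow> nat \<Rightarrow> (nat \<Rightarrow> nat) \<Rightarrow> nat \<Rightarrow> nat" where
  "raise n k \<nu> j = (if j = k then Suc (\<nu> (n - 1)) else if k < j \<and> j < n then \<nu> (j - 1) else \<nu> j)"

definition comps_from :: "nat \<Rightarrow> nat \<Rightarrow> (nat \<Rightarrow> nat) set" where
  "comps_from n k = {\<nu>. is_comp n \<nu> \<and> (\<forall>j<k. \<nu> j = 0)}"

lemma comps_from_0: "\<nu> \<in> comps_from n 0 \<longleftrightarrow> is_comp n \<nu>"
  by (simp add: comps_from_def)

lemma rot_permutes: "k < n \<Longrightarrow> rot n k permutes {k..<n}"
proof (rule bij_imp_permutes)
  assume k: "k < n"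
  show "bij_betw (rot n k) {k..<n} {k..<n}"
    by (rule bij_betw_byWitness[of _ "\<lambda>j. if j = k then n - 1 else j - 1"])
      (use k in \<open>auto simp: rot_def\<close>)
qed (auto simp: rot_def)

lemma rot_permutes_all: "k < n \<Longrightarrow> rot n k permutes {..<n}"
  by (rule permutes_subset[OF rot_permutes]) auto

lemma rot_bij: "k < n \<Longrightarrow> bij (rot n k)"
  using permutes_bij rot_permutes by blast

lemma raise_rot: "k < n \<Longrightarrow> raise n k \<nu> (rot n k i) = \<nu> i + (if Suc i = n then 1 else 0)"
  by (auto simp: raise_def rot_def)

lemma raise_comps_from: "k < n \<Longrightarrow> \<nu> \<in> comps_from n k \<Longrightarrow> raise n k \<nu> \<in> comps_from n k"
  by (auto simp: comps_from_def is_comp_def raise_def)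

lemma csize_raise: "k < n \<Longrightarrow> csize n (raise n k \<nu>) = Suc (csize n \<nu>)"
proof -
  assume k: "k < n"
  have "csize n (raise n k \<nu>) = (\<Sum>i<n. raise n k \<nu> (rot n k i))"
    unfolding csize_def using sum.permute[OF rot_permutes_all[OF k], of "raise n k \<nu>"] by (simp add: o_def)
  also have "\<dots> = csize n \<nu> + (\<Sum>i<n. if Suc i = n then 1 else 0)"
    by (simp add: raise_rot k sum.distrib csize_def)
  also have "(\<Sum>i<n. if Suc i = n then 1 else 0) = (\<Sum>i<n. if i = n - 1 then 1 else (0::nat))"
    by (rule sum.cong) auto
  finally show ?thesis using k by simp
qed

lemma raise_surj:
  assumes "k < n" "\<nu> \<in> comps_from n k" "\<nu> k > 0"
  obtains \<mu> where "\<mu> \<in> comps_from n k" "\<nu> = raise n k \<mu>"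
proof
  let ?\<mu> = "\<lambda>i. if k \<le> i \<and> Suc i < n then \<nu> (Suc i) else if Suc i = n then \<nu> k - 1 else \<nu> i"
  show "?\<mu> \<in> comps_from n k"
    using assms by (auto simp: comps_from_def is_comp_def)
  show "\<nu> = raise n k ?\<mu>"
    using assms by (auto simp: raise_def fun_eq_iff)
qed

lemma raise_inj:
  assumes "k < n" "raise n k \<mu> = raise n k \<nu>"
  shows "\<mu> = \<nu>"
proof
  fix i
  show "\<mu> i = \<nu> i"
    using raise_rot[OF assms(1), of \<mu> i] raise_rot[OF assms(1), of \<nu> i] assms(2) by simp
qed

text \<open>Ranks are preserved: the last part comes before an earlier \<open>\<nu> j\<close> iff
  \<open>\<nu> (n - 1) \<ge> \<nu> j\<close>, and this is
  \<open>Suc (\<nu> (n - 1)) > \<nu> j\<close>, the condition once it stands in front. Only the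
  raised part gains a factor \<open>qq\<close>.\<close>

lemma tilde_raise:
  assumes k: "k < n" and \<nu>: "\<nu> \<in> comps_from n k"
  shows "tilde n (raise n k \<nu>) (rot n k i) = (if Suc i = n then qq else 1) * tilde n \<nu> i"
proof (cases "i < n")
  case True
  have "kk n (raise n k \<nu>) (rot n k i) = kk n \<nu> i"
  proof (rule kk_permute[OF rot_permutes_all[OF k] True])
    fix j assume "j < n"
    then show "precedes (raise n k \<nu>) (rot n k j) (rot n k i) = precedes \<nu> j i"
      unfolding precedes_def raise_rot[OF k] using True \<nu> k
      by (auto simp: rot_def comps_from_def)
  qed
  moreover have "rot n k i < n" using True k by (auto simp: rot_def)
  ultimately show ?thesis using True by (simp add: tilde_def raise_rot k)
next
  case False
  then show ?thesis using k by (simp add: tilde_def rot_def)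
qed

text \<open>A zero part with only zeros before it is preceded by exactly the later positions,
  whatever their parts; the coordinate is always \<open>t^-(n-1-k)\<close>.\<close>

lemma tilde_first_zero:
  assumes "k < n" "\<nu> \<in> comps_from n (Suc k)"
  shows "tilde n \<nu> k = tilde n (\<lambda>_. 0) k"
proof -
  have "kk n \<nu> k = kk n (\<lambda>_. 0) k"
    unfolding kk_precedes[OF assms(1)]
    by (rule arg_cong[where f = card]) (use assms in \<open>auto simp: comps_from_def precedes_def\<close>)
  then show ?thesis using assms by (simp add: tilde_def comps_from_def)
qed

lemma tilde_first_pos: "k < n \<Longrightarrow> \<nu> k > 0 \<Longrightarrow> tilde n \<nu> k \<noteq> tilde n (\<lambda>_. 0) k"
  using tilde_eqD(1)[of n \<nu> k "\<lambda>_. 0" k] by auto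

text \<open>The substitution dual to \<open>raise\<close>: the factor \<open>1 / qq\<close> undoes
  the \<open>qq\<close> that the last coordinate gains on moving to position
  \<open>k\<close>.\<close>

definition shift :: "nat \<Rightarrow> nat \<Rightarrow> mpoly \<Rightarrow> mpoly" where
  "shift n k h = var_subst (rot n k) k (1 / qq) h"

lemma peval_shift:
  assumes "k < n" "\<nu> \<in> comps_from n k"
  shows "peval (shift n k h) (tilde n (raise n k \<nu>)) = peval h (tilde n \<nu>)"
proof -
  have "(if rot n k i = k then 1 / qq else 1) * tilde n (raise n k \<nu>) (rot n k i) = tilde n \<nu> i" for i
    using tilde_raise[OF assms, of i] assms(1) by (auto simp: rot_def)
  then show ?thesis
    unfolding shift_def by (simp add: peval_var_subst rot_bij assms)
qed

lemma poly_in_shift: "k < n \<Longrightarrow> poly_in {k..<n} d h \<Longrightarrow> poly_in {k..<n} d (shift n k h)"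
  unfolding shift_def
  using poly_in_var_subst[OF rot_bij, of k n "{k..<n}"] permutes_image[OF rot_permutes] by simp

lemma shift_surj:
  assumes k: "k < n" and h: "poly_in {k..<n} d h"
  obtains h' where "poly_in {k..<n} d h'" "h = shift n k h'"
proof
  let ?f = "rot n k"
  \<comment> \<open>The scaling at \<open>k\<close> is undone by a factor \<open>qq\<close> at
    \<open>n - 1\<close>, the index that \<open>rot n k\<close> carries to \<open>k\<close>.\<close>
  let ?h = "var_subst (inv ?f) (n - 1) qq h"
  have f': "bij (inv ?f)" by (simp add: bij_imp_bij_inv rot_bij k)
  show "poly_in {k..<n} d ?h"
    using poly_in_var_subst[OF f' h] permutes_image[OF permutes_inv[OF rot_permutes[OF k]]] by simp
  show "h = shift n k ?h"
  proof (rule poly_mapping_eqI)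
    fix m :: "nat \<Rightarrow>\<^sub>0 nat"
    have "?f (n - 1) = k" using k by (auto simp: rot_def)
    then have "lookup (Poly_Mapping.map_key ?f m) (n - 1) = lookup m k"
      using k by (simp add: map_key.rep_eq bij_is_inj rot_bij)
    then show "lookup h m = lookup (shift n k ?h) m"
      by (simp add: shift_def lookup_var_subst rot_bij k f' map_key_inv field_simps)
  qed
qed

section \<open>Interpolation\<close>

text \<open>Double induction on the number \<open>n - k\<close> of variables and on the degree
  bound. In \<open>g = r + (x_k - c) h\<close> the remainder vanishes at the nodes with
  \<open>\<nu> k = 0\<close>, so the outer hypothesis gives \<open>r = 0\<close>. At raised nodes
  the linear factor is nonzero, so \<open>h\<close> pulled back along \<open>shift\<close> falls
  under the inner hypothesis.\<close>

theorem interpolation_unique: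
  assumes "k \<le> n" "poly_in {k..<n} d g"
    "\<And>\<nu>. \<nu> \<in> comps_from n k \<Longrightarrow> csize n \<nu> < d \<Longrightarrow> peval g (tilde n \<nu>) = 0"
  shows "g = 0"
  using assms
proof (induction "n - k" arbitrary: k d g)
  case 0
  have const: "m = 0" if "lookup g m \<noteq> 0" for m
    using that 0 by (auto simp: poly_in_def)
  show ?case
  proof (rule ccontr)
    assume "g \<noteq> 0"
    then obtain m where m: "lookup g m \<noteq> 0" by (metis poly_mapping_eqI lookup_zero)
    then have "d > 0" using 0 by (auto simp: poly_in_def)
    then have "peval g (tilde n (\<lambda>_. 0)) = 0"
      using 0 by (auto simp: comps_from_def is_comp_def csize_def)
    moreover have "peval g x = lookup g 0" for x
      by (subst peval_superset[of "{0}"]) (auto simp: in_keys_iff const mon_eval_def)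
    ultimately show False using m const by metis
  qed
next
  case (Suc l)
  then have k: "k < n" by simp
  from Suc.prems show ?case
  proof (induction d arbitrary: g)
    case 0
    then show ?case by (simp add: poly_in_zero_bound)
  next
    case (Suc d)
    note outer = \<open>\<And>k d g. l = n - k \<Longrightarrow> k \<le> n \<Longrightarrow> poly_in {k..<n} d g \<Longrightarrow>
      (\<And>\<nu>. \<nu> \<in> comps_from n k \<Longrightarrow> csize n \<nu> < d \<Longrightarrow> peval g (tilde n \<nu>) = 0) \<Longrightarrow> g = 0\<close>
    let ?c = "tilde n (\<lambda>_. 0) k"
    obtain r h where g: "g = r + (Xv k - Cst ?c) * h" and r: "poly_in ({k..<n} - {k}) (Suc d) r"
      and h: "poly_in {k..<n} d h"
      using linear_division[OF Suc.prems(2), of k ?c] k by auto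
    have ev: "peval g x = peval r x + (x k - ?c) * peval h x" for x
      unfolding g by (simp add: peval_add peval_mult peval_minus)
    have "{k..<n} - {k} = {Suc k..<n}" by auto
    then have r0: "r = 0"
    proof (intro outer[of "Suc k" "Suc d" r])
      fix \<nu> assume \<nu>: "\<nu> \<in> comps_from n (Suc k)" "csize n \<nu> < Suc d"
      then have "\<nu> \<in> comps_from n k" by (auto simp: comps_from_def)
      then show "peval r (tilde n \<nu>) = 0"
        using Suc.prems(3) \<nu> ev[of "tilde n \<nu>"] tilde_first_zero[OF k] by simp
    qed (use r k \<open>Suc l = n - k\<close> in auto)
    obtain h' where h': "poly_in {k..<n} d h'" "h = shift n k h'"
      using shift_surj[OF k h] .
    have "h' = 0"
    proof (rule Suc.IH[OF _ h'(1)])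
      fix \<nu> assume \<nu>: "\<nu> \<in> comps_from n k" "csize n \<nu> < d"
      let ?\<nu> = "raise n k \<nu>"
      have "peval g (tilde n ?\<nu>) = 0"
        using Suc.prems(3) \<nu> k by (simp add: raise_comps_from csize_raise)
      moreover have "tilde n ?\<nu> k \<noteq> ?c" by (rule tilde_first_pos) (simp_all add: k raise_def)
      ultimately show "peval h' (tilde n \<nu>) = 0"
        using ev[of "tilde n ?\<nu>"] peval_shift[OF k \<nu>(1), of h'] h'(2) r0 by simp
    qed (use k in auto)
    then have "h = 0"
      using h'(2) k by (auto intro!: poly_mapping_eqI simp: shift_def lookup_var_subst rot_bij)
    then show ?case using g r0 by simp
  qed
qed

text \<open>The same recursion read constructively: \<open>r\<close> takes the prescribed values at
  the nodes with \<open>\<nu> k = 0\<close>, and a multiple of \<open>x_k - c\<close>, which is zero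
  there, corrects the values at the raised nodes.\<close>

theorem interpolation_exists:
  assumes "k \<le> n"
  shows "\<exists>g. poly_in {k..<n} d g \<and> (\<forall>\<nu>\<in>comps_from n k. csize n \<nu> < d \<longrightarrow> peval g (tilde n \<nu>) = v \<nu>)"
  using assms
proof (induction "n - k" arbitrary: k d v)
  case 0
  show ?case
  proof (cases d)
    case 0
    then show ?thesis by (intro exI[of _ 0]) simp
  next
    case (Suc d')
    have "\<nu> = (\<lambda>_. 0)" if "\<nu> \<in> comps_from n k" for \<nu>
      using that 0 by (auto simp: comps_from_def is_comp_def fun_eq_iff not_less[symmetric])
    moreover have "poly_in {k..<n} d (Cst (v (\<lambda>_. 0)))"
      using Suc by (auto simp: poly_in_def Cst_def lookup_single when_def tdeg_def)
    ultimately show ?thesis by (intro exI[of _ "Cst (v (\<lambda>_. 0))"]) auto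
  qed
next
  case (Suc l)
  then have k: "k < n" by simp
  note outer = Suc.hyps(1)[of "Suc k"]
  show ?case
  proof (induction d arbitrary: v)
    case 0
    show ?case by (intro exI[of _ 0]) simp
  next
    case (Suc d)
    let ?c = "tilde n (\<lambda>_. 0) k"
    obtain r where r: "poly_in {Suc k..<n} (Suc d) r"
      "\<And>\<nu>. \<nu> \<in> comps_from n (Suc k) \<Longrightarrow> csize n \<nu> < Suc d \<Longrightarrow> peval r (tilde n \<nu>) = v \<nu>"
      using outer[of "Suc d" v] k \<open>Suc l = n - k\<close> by (metis Suc_diff_Suc Suc_inject Suc_leI)
    \<comment> \<open>The prescribed value is the error of \<open>r\<close> at the raised node
      divided by the linear factor, which is nonzero there.\<close>
    obtain h where h: "poly_in {k..<n} d h"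
      "\<And>\<nu>. \<nu> \<in> comps_from n k \<Longrightarrow> csize n \<nu> < d \<Longrightarrow> peval h (tilde n \<nu>) =
        (v (raise n k \<nu>) - peval r (tilde n (raise n k \<nu>))) / (tilde n (raise n k \<nu>) k - ?c)"
      using Suc.IH[of "\<lambda>\<nu>. (v (raise n k \<nu>) - peval r (tilde n (raise n k \<nu>))) / (tilde n (raise n k \<nu>) k - ?c)"]
      by blast
    let ?g = "r + (Xv k * shift n k h - Cst ?c * shift n k h)"
    have "poly_in {k..<n} (Suc d) ?g"
      using r(1) h(1) k
      by (intro poly_in_add poly_in_minus poly_in_Xv_mult poly_in_Cst_mult poly_in_shift)
        (auto intro: poly_in_mono poly_in_shift)
    moreover have "peval ?g (tilde n \<nu>) = v \<nu>" if \<nu>: "\<nu> \<in> comps_from n k" "csize n \<nu> < Suc d" for \<nu>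
    proof -
      have ev: "peval ?g x = peval r x + (x k - ?c) * peval (shift n k h) x" for x
        by (simp add: peval_add peval_mult peval_minus algebra_simps)
      show ?thesis
      proof (cases "\<nu> k = 0")
        case True
        then have "\<nu> \<in> comps_from n (Suc k)" using \<nu> by (auto simp: comps_from_def less_Suc_eq)
        then show ?thesis using r(2) \<nu> ev tilde_first_zero[OF k] by simp
      next
        case False
        then obtain \<mu> where \<mu>: "\<mu> \<in> comps_from n k" "\<nu> = raise n k \<mu>"
          using raise_surj[OF k \<nu>(1)] by auto
        have "tilde n \<nu> k \<noteq> ?c" using False tilde_first_pos[OF k] by simp
        then show ?thesis
          using h(2)[OF \<mu>(1)] \<nu>(2) \<mu>(2) csize_raise[OF k, of \<mu>] ev peval_shift[OF k \<mu>(1), of h] by simp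
      qed
    qed
    ultimately show ?case by blast
  qed
qed

section \<open>Fundamental interpolation polynomials\<close>

text \<open>Normalised by the value at its own node instead of a coefficient: that the coefficient
  of \<open>x^\<mu>\<close> is nonzero, as the normalisation of \<open>Estar\<close> presupposes, is
  only established by \<open>triangular\<close>.\<close>

definition lagrange :: "nat \<Rightarrow> (nat \<Rightarrow> nat) \<Rightarrow> mpoly" where
  "lagrange n \<mu> = (SOME g. poly_in {..<n} (Suc (csize n \<mu>)) g \<and>
     (\<forall>\<nu>. is_comp n \<nu> \<and> csize n \<nu> \<le> csize n \<mu> \<longrightarrow> peval g (tilde n \<nu>) = (if \<nu> = \<mu> then 1 else 0)))"

lemma lagrange:
  shows poly_in_lagrange: "poly_in {..<n} (Suc (csize n \<mu>)) (lagrange n \<mu>)"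
    and peval_lagrange: "is_comp n \<nu> \<Longrightarrow> csize n \<nu> \<le> csize n \<mu> \<Longrightarrow>
      peval (lagrange n \<mu>) (tilde n \<nu>) = (if \<nu> = \<mu> then 1 else 0)"
proof -
  have "\<exists>g. poly_in {..<n} (Suc (csize n \<mu>)) g \<and>
     (\<forall>\<nu>. is_comp n \<nu> \<and> csize n \<nu> \<le> csize n \<mu> \<longrightarrow> peval g (tilde n \<nu>) = (if \<nu> = \<mu> then 1 else 0))"
    using interpolation_exists[of 0 n "Suc (csize n \<mu>)" "\<lambda>\<nu>. if \<nu> = \<mu> then 1 else 0"]
    by (auto simp: comps_from_0 less_Suc_eq_le lessThan_atLeast0)
  from someI_ex[OF this] show "poly_in {..<n} (Suc (csize n \<mu>)) (lagrange n \<mu>)"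
    "is_comp n \<nu> \<Longrightarrow> csize n \<nu> \<le> csize n \<mu> \<Longrightarrow>
      peval (lagrange n \<mu>) (tilde n \<nu>) = (if \<nu> = \<mu> then 1 else 0)"
    unfolding lagrange_def by blast+
qed

lemma poly_eq_zero_if_vanishing:
  assumes "poly_in {..<n} (Suc d) g" "\<And>\<nu>. is_comp n \<nu> \<Longrightarrow> csize n \<nu> \<le> d \<Longrightarrow> peval g (tilde n \<nu>) = 0"
  shows "g = 0"
  by (rule interpolation_unique[of 0 n "Suc d"])
    (use assms in \<open>auto simp: comps_from_0 less_Suc_eq_le lessThan_atLeast0\<close>)

lemma lagrange_unique:
  assumes \<mu>: "is_comp n \<mu>" and g: "poly_in {..<n} (Suc (csize n \<mu>)) g"
    and van: "\<And>\<nu>. is_comp n \<nu> \<Longrightarrow> csize n \<nu> \<le> csize n \<mu> \<Longrightarrow> \<nu> \<noteq> \<mu> \<Longrightarrow> peval g (tilde n \<nu>) = 0"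
  shows "g = Cst (peval g (tilde n \<mu>)) * lagrange n \<mu>"
proof -
  have "g - Cst (peval g (tilde n \<mu>)) * lagrange n \<mu> = 0"
    by (rule poly_eq_zero_if_vanishing[of n "csize n \<mu>"])
      (use assms in \<open>auto intro!: poly_in_minus poly_in_Cst_mult poly_in_lagrange
        simp: peval_minus peval_mult peval_lagrange\<close>)
  then show ?thesis by simp
qed

text \<open>Triangularity concerns only which coefficients vanish, so a polynomial known up to a
  nonzero scalar is enough.\<close>

lemma coeffx_lagrange_iff:
  assumes "is_comp n \<mu>" "poly_in {..<n} (Suc (csize n \<mu>)) g"
    "\<And>\<nu>. is_comp n \<nu> \<Longrightarrow> csize n \<nu> \<le> csize n \<mu> \<Longrightarrow> \<nu> \<noteq> \<mu> \<Longrightarrow> peval g (tilde n \<nu>) = 0"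
    and "g \<noteq> 0"
  shows "coeffx (lagrange n \<mu>) \<rho> = 0 \<longleftrightarrow> coeffx g \<rho> = 0"
proof -
  let ?v = "peval g (tilde n \<mu>)"
  have g: "g = Cst ?v * lagrange n \<mu>" by (rule lagrange_unique) (use assms in auto)
  then have "?v \<noteq> 0" using assms(4) by (auto simp: Cst_def)
  moreover have "coeffx g \<rho> = ?v * coeffx (lagrange n \<mu>) \<rho>"
    using g coeffx_Cst_mult by metis
  ultimately show ?thesis by simp
qed

section \<open>Top coefficients under raising\<close>

lemma is_comp_monomial:
  assumes "is_comp n \<rho>"
  shows "lookup (Abs_poly_mapping \<rho>) = \<rho>" "keys (Abs_poly_mapping \<rho>) \<subseteq> {..<n}"
    "tdeg (Abs_poly_mapping \<rho>) = csize n \<rho>"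
proof -
  show l: "lookup (Abs_poly_mapping \<rho>) = \<rho>"
    by (rule lookup_Abs_poly_mapping) (rule is_comp_finite[OF assms])
  show k: "keys (Abs_poly_mapping \<rho>) \<subseteq> {..<n}"
    using assms by (auto simp: in_keys_iff l is_comp_def not_less[symmetric])
  show "tdeg (Abs_poly_mapping \<rho>) = csize n \<rho>"
    using tdeg_superset[OF _ k] by (simp add: l csize_def)
qed

text \<open>The term with \<open>c\<close> has too small a degree to contribute, and the
  substitution only multiplies coefficients by nonzero powers of \<open>1 / qq\<close>.\<close>

lemma coeffx_raise:
  assumes n: "0 < n" and h: "poly_in {..<n} (Suc d) h" and \<nu>: "is_comp n \<nu>" "csize n \<nu> = d"
  shows "coeffx (Xv 0 * shift n 0 h - Cst c * shift n 0 h) (raise n 0 \<nu>) = 0 \<longleftrightarrow> coeffx h \<nu> = 0"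
proof -
  let ?\<rho> = "raise n 0 \<nu>" and ?S = "shift n 0 h"
  have \<rho>: "is_comp n ?\<rho>" using raise_comps_from[OF n, of \<nu>] \<nu> by (simp add: comps_from_0)
  have size: "csize n ?\<rho> = Suc d" using csize_raise[OF n] \<nu> by simp
  have "poly_in {..<n} (Suc d) ?S"
    using poly_in_shift[OF n, of "Suc d" h] h by (simp add: lessThan_atLeast0)
  then have top: "lookup ?S (Abs_poly_mapping ?\<rho>) = 0"
    using is_comp_monomial(3)[OF \<rho>] size unfolding poly_in_def by auto
  \<comment> \<open>The monomial of \<open>raise n 0 \<nu>\<close> divided by its first
    variable.\<close>
  define M where "M = Abs_poly_mapping (?\<rho>(0 := \<nu> (n - 1)))"
  have "is_comp n (?\<rho>(0 := \<nu> (n - 1)))" using \<rho> n by (auto simp: is_comp_def)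
  then have M: "lookup M = ?\<rho>(0 := \<nu> (n - 1))" unfolding M_def by (rule is_comp_monomial)
  have \<rho>M: "Abs_poly_mapping ?\<rho> = single 0 1 + M"
    by (rule poly_mapping_eqI)
      (auto simp: is_comp_monomial(1)[OF \<rho>] lookup_add M lookup_single when_def raise_def)
  have "Poly_Mapping.map_key (rot n 0) M = Abs_poly_mapping \<nu>"
  proof (rule poly_mapping_eqI)
    fix i
    have "rot n 0 i = 0 \<longleftrightarrow> i = n - 1" using n by (auto simp: rot_def)
    then show "lookup (Poly_Mapping.map_key (rot n 0) M) i = lookup (Abs_poly_mapping \<nu>) i"
      using raise_rot[OF n, of \<nu> i] n
      by (auto simp: map_key.rep_eq bij_is_inj rot_bij M is_comp_monomial(1)[OF \<nu>(1)])
  qed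
  then have "lookup ?S M = (1 / qq) ^ lookup M 0 * coeffx h \<nu>"
    by (simp add: shift_def lookup_var_subst rot_bij n coeffx_def)
  moreover have "coeffx (Xv 0 * ?S - Cst c * ?S) ?\<rho> = lookup ?S M"
    using top unfolding coeffx_def \<rho>M lookup_minus lookup_Cst_mult lookup_Xv_mult by simp
  ultimately show ?thesis by simp
qed

text \<open>\<open>(x_0 - c) * shift n 0 (lagrange n \<mu>)\<close> vanishes at the right nodes and
  is nonzero, so it is a multiple of the raised interpolation polynomial. Its top monomials all
  contain \<open>x_0\<close> and so come from raised compositions.\<close>

lemma coeffx_lagrange_raise:
  assumes n: "0 < n" and \<mu>: "is_comp n \<mu>" and \<rho>: "is_comp n \<rho>" "csize n \<rho> = Suc (csize n \<mu>)"
  shows "coeffx (lagrange n (raise n 0 \<mu>)) \<rho> \<noteq> 0 \<longleftrightarrow>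
    (\<exists>\<nu>. is_comp n \<nu> \<and> \<rho> = raise n 0 \<nu> \<and> coeffx (lagrange n \<mu>) \<nu> \<noteq> 0)"
proof -
  let ?c = "tilde n (\<lambda>_. 0) 0" and ?h = "lagrange n \<mu>"
  let ?S = "shift n 0 ?h"
  let ?g = "Xv 0 * ?S - Cst ?c * ?S"
  have ev: "peval ?g x = (x 0 - ?c) * peval ?S x" for x
    by (simp add: peval_minus peval_mult algebra_simps)
  have raise_comp: "is_comp n (raise n 0 \<nu>)" if "is_comp n \<nu>" for \<nu>
    using raise_comps_from[OF n, of \<nu>] that by (simp add: comps_from_0)
  have S: "poly_in {..<n} (Suc (csize n \<mu>)) ?S"
    using poly_in_shift[OF n, of _ ?h] poly_in_lagrange[of n \<mu>] by (simp add: lessThan_atLeast0)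
  have g: "poly_in {..<n} (Suc (csize n (raise n 0 \<mu>))) ?g"
    unfolding csize_raise[OF n]
    by (intro poly_in_minus poly_in_Xv_mult S poly_in_Cst_mult) (use n S in \<open>auto intro: poly_in_mono\<close>)
  have van: "peval ?g (tilde n \<nu>) = 0"
    if \<nu>: "is_comp n \<nu>" "csize n \<nu> \<le> csize n (raise n 0 \<mu>)" "\<nu> \<noteq> raise n 0 \<mu>" for \<nu>
  proof (cases "\<nu> 0 = 0")
    case True
    then show ?thesis
      using tilde_first_zero[OF n, of \<nu>] \<nu> ev by (simp add: comps_from_def)
  next
    case False
    then obtain \<kappa> where \<kappa>: "is_comp n \<kappa>" "\<nu> = raise n 0 \<kappa>"
      using raise_surj[OF n, of \<nu>] \<nu> by (auto simp: comps_from_0)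
    then have "peval ?S (tilde n \<nu>) = peval ?h (tilde n \<kappa>)"
      using peval_shift[OF n, of \<kappa>] by (simp add: comps_from_0)
    also have "\<dots> = 0"
      using \<kappa> \<nu> by (subst peval_lagrange) (auto simp: csize_raise n)
    finally show ?thesis using ev by simp
  qed
  have "peval ?g (tilde n (raise n 0 \<mu>)) \<noteq> 0"
    using tilde_first_pos[OF n, of "raise n 0 \<mu>"] peval_shift[OF n, of \<mu> ?h] \<mu> ev
    by (simp add: comps_from_0 peval_lagrange raise_def)
  then have g0: "?g \<noteq> 0" by auto
  have iff: "coeffx (lagrange n (raise n 0 \<mu>)) \<rho> = 0 \<longleftrightarrow> coeffx ?g \<rho> = 0"
    by (rule coeffx_lagrange_iff) (use raise_comp \<mu> g van g0 in auto)
  show ?thesis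
  proof (cases "\<rho> 0 = 0")
    case True
    have "lookup ?S (Abs_poly_mapping \<rho>) = 0"
      using is_comp_monomial(3)[OF \<rho>(1)] \<rho>(2) S unfolding poly_in_def by auto
    moreover have "lookup (Xv 0 * ?S) (Abs_poly_mapping \<rho>) = 0"
      by (rule lookup_Xv_mult_0) (simp add: is_comp_monomial(1)[OF \<rho>(1)] True)
    ultimately have "coeffx ?g \<rho> = 0" by (simp add: coeffx_def lookup_minus)
    then show ?thesis using iff True by (auto simp: raise_def)
  next
    case False
    then obtain \<nu> where \<nu>: "is_comp n \<nu>" "\<rho> = raise n 0 \<nu>"
      using raise_surj[OF n, of \<rho>] \<rho> by (auto simp: comps_from_0)
    have "csize n \<nu> = csize n \<mu>" using \<rho>(2) \<nu>(2) csize_raise[OF n] by simp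
    then have "coeffx ?g \<rho> = 0 \<longleftrightarrow> coeffx ?h \<nu> = 0"
      using coeffx_raise[OF n poly_in_lagrange \<nu>(1)] \<nu>(2) by simp
    then show ?thesis using iff \<nu> raise_inj[OF n] by metis
  qed
qed

lemma is_comp_raises: "0 < n \<Longrightarrow> is_comp n \<nu> \<Longrightarrow> is_comp n ((raise n 0 ^^ k) \<nu>)"
  by (induction k) (simp_all add: raise_comps_from flip: comps_from_0)

lemma csize_raises: "0 < n \<Longrightarrow> csize n ((raise n 0 ^^ k) \<nu>) = csize n \<nu> + k"
  by (induction k) (auto simp: csize_raise)

lemma coeffx_lagrange_raises:
  assumes n: "0 < n" and \<mu>: "is_comp n \<mu>" and "is_comp n \<rho>" "csize n \<rho> = csize n \<mu> + k"
  shows "coeffx (lagrange n ((raise n 0 ^^ k) \<mu>)) \<rho> \<noteq> 0 \<longleftrightarrow>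
    (\<exists>\<nu>. is_comp n \<nu> \<and> \<rho> = (raise n 0 ^^ k) \<nu> \<and> coeffx (lagrange n \<mu>) \<nu> \<noteq> 0)"
  using assms(3,4)
proof (induction k arbitrary: \<rho>)
  case 0
  then show ?case by auto
next
  case (Suc k)
  have "coeffx (lagrange n ((raise n 0 ^^ Suc k) \<mu>)) \<rho> \<noteq> 0 \<longleftrightarrow>
     (\<exists>\<nu>. is_comp n \<nu> \<and> \<rho> = raise n 0 \<nu> \<and> coeffx (lagrange n ((raise n 0 ^^ k) \<mu>)) \<nu> \<noteq> 0)"
    using coeffx_lagrange_raise[OF n is_comp_raises[OF n \<mu>] Suc.prems(1)] Suc.prems(2)
    by (simp add: csize_raises n)
  also have "\<dots> \<longleftrightarrow> (\<exists>\<nu>. is_comp n \<nu> \<and> \<rho> = (raise n 0 ^^ Suc k) \<nu> \<and> coeffx (lagrange n \<mu>) \<nu> \<noteq> 0)"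
  proof -
    have "csize n \<nu> = csize n \<mu> + k" if "\<rho> = raise n 0 \<nu>" for \<nu>
      using that Suc.prems(2) by (simp add: csize_raise n)
    then have IH: "coeffx (lagrange n ((raise n 0 ^^ k) \<mu>)) \<nu> \<noteq> 0 \<longleftrightarrow>
        (\<exists>\<kappa>. is_comp n \<kappa> \<and> \<nu> = (raise n 0 ^^ k) \<kappa> \<and> coeffx (lagrange n \<mu>) \<kappa> \<noteq> 0)"
      if "is_comp n \<nu>" "\<rho> = raise n 0 \<nu>" for \<nu>
      using Suc.IH that by blast
    show ?thesis
    proof
      assume "\<exists>\<nu>. is_comp n \<nu> \<and> \<rho> = (raise n 0 ^^ Suc k) \<nu> \<and> coeffx (lagrange n \<mu>) \<nu> \<noteq> 0"
      then obtain \<kappa> where \<kappa>: "is_comp n \<kappa>" "\<rho> = raise n 0 ((raise n 0 ^^ k) \<kappa>)"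
        "coeffx (lagrange n \<mu>) \<kappa> \<noteq> 0" by auto
      then show "\<exists>\<nu>. is_comp n \<nu> \<and> \<rho> = raise n 0 \<nu> \<and>
          coeffx (lagrange n ((raise n 0 ^^ k) \<mu>)) \<nu> \<noteq> 0"
        using IH[OF is_comp_raises[OF n \<kappa>(1)] \<kappa>(2)] is_comp_raises[OF n \<kappa>(1)] by blast
    qed (use IH in auto)
  qed
  finally show ?case .
qed

text \<open>Since \<open>k \<le> n\<close>, each part comes to the front at most once and is raised
  at most by one.\<close>

lemma raises_apply:
  "k \<le> n \<Longrightarrow> (raise n 0 ^^ k) \<nu> j = (if j < k then Suc (\<nu> (n - k + j)) else if j < n then \<nu> (j - k) else \<nu> j)"
proof (induction k arbitrary: j)
  case 0
  then show ?case by simp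
next
  case (Suc k)
  then show ?case
    by (cases j) (auto simp: raise_def Suc_diff_Suc)
qed

lemma sum_raises:
  assumes "k \<le> n"
  shows "(\<Sum>j<n. F ((raise n 0 ^^ k) \<nu> j)) = (\<Sum>i<n. F (\<nu> i + (if n - k \<le> i then 1 else 0)))"
  by (rule sum.reindex_bij_witness[of _ "\<lambda>i. if i < n - k then i + k else i - (n - k)"
        "\<lambda>j. if j < k then n - k + j else j - k"])
    (use assms in \<open>auto simp: raises_apply\<close>)

section \<open>Ascents\<close>

text \<open>All pairs count, not only adjacent ones; on the orbit of a partition this is the length
  of the shortest permutation reaching \<open>\<mu>\<close>.\<close>

definition asc :: "nat \<Rightarrow> (nat \<Rightarrow> nat) \<Rightarrow> nat" where
  "asc n \<mu> = card {(i, j). i < j \<and> j < n \<and> \<mu> i < \<mu> j}"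

lemma finite_pairs [simp]: "finite {(i, j). i < j \<and> j < n \<and> P i j}" for n :: nat
  by (rule finite_subset[of _ "{..<n} \<times> {..<n}"]) auto

text \<open>The transposition permutes the pairs other than \<open>(i, Suc i)\<close>, and that pair
  becomes the one new ascent.\<close>

lemma asc_transpose:
  assumes "Suc i < n" "\<mu> i > \<mu> (Suc i)"
  shows "asc n (\<mu> \<circ> Transposition.transpose i (Suc i)) = Suc (asc n \<mu>)"
proof -
  let ?s = "Transposition.transpose i (Suc i)"
  let ?A = "{(a, b). a < b \<and> b < n \<and> \<mu> a < \<mu> b}"
  let ?B = "{(a, b). a < b \<and> b < n \<and> (\<mu> \<circ> ?s) a < (\<mu> \<circ> ?s) b}"
  have mono: "?s a < ?s b \<and> ?s b < n" if "a < b" "b < n" "(a, b) \<noteq> (i, Suc i)" for a b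
    using that assms(1) by (auto simp: Transposition.transpose_def)
  have ss: "(?s (?s a), ?s (?s b)) = (a, b)" for a b by simp
  have "?B = insert (i, Suc i) (map_prod ?s ?s ` ?A)"
  proof (intro equalityI subsetI)
    fix p assume "p \<in> ?B"
    then obtain a b where p: "p = (a, b)" "a < b" "b < n" "\<mu> (?s a) < \<mu> (?s b)" by auto
    show "p \<in> insert (i, Suc i) (map_prod ?s ?s ` ?A)"
    proof (cases "(a, b) = (i, Suc i)")
      case False
      then have "(?s a, ?s b) \<in> ?A" using mono p by auto
      then show ?thesis using p(1) ss by (metis (no_types, lifting) image_eqI insertI2 map_prod_simp)
    qed (use p in auto)
  next
    fix p assume "p \<in> insert (i, Suc i) (map_prod ?s ?s ` ?A)"
    then show "p \<in> ?B"
    proof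
      assume "p = (i, Suc i)"
      then show ?thesis using assms by auto
    next
      assume "p \<in> map_prod ?s ?s ` ?A"
      then obtain a b where p: "p = (?s a, ?s b)" "a < b" "b < n" "\<mu> a < \<mu> b" by auto
      then have "(a, b) \<noteq> (i, Suc i)" using assms(2) by auto
      then show ?thesis using mono p by auto
    qed
  qed
  moreover have "(i, Suc i) \<notin> map_prod ?s ?s ` ?A"
    by (auto simp: Transposition.transpose_def split: if_splits)
  moreover have "card (map_prod ?s ?s ` ?A) = card ?A"
    by (rule card_image) (rule inj_on_subset[OF prod.inj_map], auto)
  ultimately show ?thesis unfolding asc_def by simp
qed

lemma transpose_fix:
  assumes "\<mu> i = \<mu> (Suc i)"
  shows "\<mu> \<circ> Transposition.transpose i (Suc i) = \<mu>"
  using assms by (auto simp: fun_eq_iff Transposition.transpose_def)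

lemma asc_transpose':
  assumes "Suc i < n" "\<mu> i < \<mu> (Suc i)"
  shows "asc n \<mu> = Suc (asc n (\<mu> \<circ> Transposition.transpose i (Suc i)))"
  using asc_transpose[OF assms(1), of "\<mu> \<circ> Transposition.transpose i (Suc i)"] assms(2)
  by (simp add: comp_assoc)

lemma asc_transpose_le:
  assumes "Suc i < n"
  shows "asc n (\<mu> \<circ> Transposition.transpose i (Suc i)) \<le> Suc (asc n \<mu>)"
proof (cases "\<mu> i" "\<mu> (Suc i)" rule: linorder_cases)
  case less
  from asc_transpose'[of i n \<mu>, OF assms less] show ?thesis by linarith
next
  case equal
  from transpose_fix[OF equal] show ?thesis by (simp only:)
next
  case greater
  from asc_transpose[of i n \<mu>, OF assms greater] show ?thesis by linarith
qed

lemma profile_permute: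
  assumes "\<sigma> permutes {..<n}"
  shows "profile n (\<mu> \<circ> \<sigma>) = profile n \<mu>"
  unfolding profile_def using sum.permute[OF assms, of "\<lambda>j. \<mu> j - _"] by (auto simp: o_def)

lemma csize_permute: "\<sigma> permutes {..<n} \<Longrightarrow> csize n (\<mu> \<circ> \<sigma>) = csize n \<mu>"
  by (metis profile_0 profile_permute)

lemma is_comp_permute: "\<sigma> permutes {..<n} \<Longrightarrow> is_comp n \<mu> \<Longrightarrow> is_comp n (\<mu> \<circ> \<sigma>)"
  by (auto simp: is_comp_def permutes_def)

text \<open>Truncation at \<open>1\<close> takes one from each nonzero part, so the profile
  determines the number of nonzero parts.\<close>

lemma card_pos_profile: "card {j. j < n \<and> \<rho> j > 0} + profile n \<rho> 1 = profile n \<rho> 0"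
proof -
  have "card {j. j < n \<and> \<rho> j > 0} = (\<Sum>j<n. if \<rho> j > 0 then 1 else 0)"
    by (simp add: sum.If_cases Collect_conj_eq lessThan_def Int_commute)
  then show ?thesis unfolding profile_def by (simp flip: sum.distrib) (rule sum.cong, auto)
qed

section \<open>Triangularity of the top coefficients\<close>

text \<open>A partition has no ascents, so for it the last clause covers all other members of the
  orbit.\<close>

definition triangular :: "nat \<Rightarrow> (nat \<Rightarrow> nat) \<Rightarrow> bool" where
  "triangular n \<mu> \<longleftrightarrow> coeffx (lagrange n \<mu>) \<mu> \<noteq> 0 \<and> top_dominated n (lagrange n \<mu>) \<mu> \<and>
    (\<forall>\<rho>. is_comp n \<rho> \<and> profile n \<rho> = profile n \<mu> \<and> \<rho> \<noteq> \<mu> \<and> asc n \<mu> \<le> asc n \<rho> \<longrightarrow>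
      coeffx (lagrange n \<mu>) \<rho> = 0)"

text \<open>Among the nodes in question \<open>Top i (lagrange n \<mu>)\<close> can be nonzero only
  at those of \<open>\<mu>\<close> and its swap; subtracting a multiple of
  \<open>lagrange n \<mu>\<close> removes the first, which yields the interpolation polynomial of
  the swap up to a scalar.\<close>

lemma triangular_transpose:
  assumes tri: "triangular n \<mu>" and \<mu>: "is_comp n \<mu>" and i: "Suc i < n" and desc: "\<mu> i > \<mu> (Suc i)"
  shows "triangular n (\<mu> \<circ> Transposition.transpose i (Suc i))"
proof -
  let ?s = "Transposition.transpose i (Suc i)"
  let ?\<mu> = "\<mu> \<circ> ?s" and ?G = "lagrange n \<mu>"
  have s: "?s permutes {..<n}" by (rule transpose_permutes[OF i])
  have ss: "\<rho> \<circ> ?s \<circ> ?s = \<rho>" for \<rho> :: "nat \<Rightarrow> nat" by (simp add: comp_assoc)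
  \<comment> \<open>\<open>lagrange n \<mu>\<close> takes the value \<open>1\<close> at its own
    node, so this multiple cancels the value there.\<close>
  define a where "a = peval (Top i ?G) (tilde n \<mu>)"
  define H where "H = Top i ?G - Cst a * ?G"
  have dom: "top_dominated n ?G \<mu>" and lead: "coeffx ?G \<mu> \<noteq> 0"
    and tri0: "\<And>\<rho>. is_comp n \<rho> \<Longrightarrow> profile n \<rho> = profile n \<mu> \<Longrightarrow> \<rho> \<noteq> \<mu> \<Longrightarrow> asc n \<mu> \<le> asc n \<rho> \<Longrightarrow>
      coeffx ?G \<rho> = 0"
    using tri by (auto simp: triangular_def)
  have prof: "profile n ?\<mu> = profile n \<mu>" and size: "csize n ?\<mu> = csize n \<mu>" and comp: "is_comp n ?\<mu>"
    using profile_permute[OF s] csize_permute[OF s] is_comp_permute[OF s \<mu>] by auto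
  have asc: "asc n ?\<mu> = Suc (asc n \<mu>)" by (rule asc_transpose[OF i desc])
  have ne: "?\<mu> \<noteq> \<mu>" using asc by force
  have H: "poly_in {..<n} (Suc (csize n ?\<mu>)) H"
    unfolding H_def size
    by (intro poly_in_minus poly_in_Top poly_in_Cst_mult poly_in_lagrange) (use i in auto)
  have van: "peval H (tilde n \<nu>) = 0" if \<nu>: "is_comp n \<nu>" "csize n \<nu> \<le> csize n ?\<mu>" "\<nu> \<noteq> ?\<mu>" for \<nu>
  proof (cases "\<nu> = \<mu>")
    case True
    then show ?thesis using \<mu> by (simp add: H_def peval_minus peval_mult peval_lagrange a_def)
  next
    case False
    have G0: "peval ?G (tilde n \<nu>) = 0" using \<nu> False size by (simp add: peval_lagrange)
    have "\<nu> \<circ> ?s \<noteq> \<mu>" using \<nu>(3) ss by metis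
    then have "peval ?G (tilde n (\<nu> \<circ> ?s)) = 0"
      using \<nu> size is_comp_permute[OF s \<nu>(1)] csize_permute[OF s, of \<nu>] by (simp add: peval_lagrange)
    then have "peval (Top i ?G) (tilde n \<nu>) = 0"
      using peval_Top_tilde_zero[OF i G0] by simp
    then show ?thesis using G0 by (simp add: H_def peval_minus peval_mult)
  qed
  have coefH: "coeffx H \<rho> = coeffx (Top i ?G) \<rho> - a * coeffx ?G \<rho>" for \<rho>
    by (simp add: H_def coeffx_def lookup_minus)
  have "coeffx ?G ?\<mu> = 0" using tri0[OF comp prof ne] asc by simp
  then have leadH: "coeffx H ?\<mu> \<noteq> 0"
    unfolding coefH coeffx_Top_orbit[OF dom i comp prof] using desc lead by (simp add: ss)
  then have "H \<noteq> 0" by (auto simp: coeffx_def)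
  then have iff: "coeffx (lagrange n ?\<mu>) \<rho> = 0 \<longleftrightarrow> coeffx H \<rho> = 0" for \<rho>
    by (intro coeffx_lagrange_iff[OF comp H van])
  have "top_dominated n (lagrange n ?\<mu>) ?\<mu>"
    unfolding top_dominated_def size prof
  proof (intro allI impI, elim conjE)
    fix \<nu> x assume \<nu>: "is_comp n \<nu>" "csize n \<nu> = csize n \<mu>" "coeffx (lagrange n ?\<mu>) \<nu> \<noteq> 0"
    then have "coeffx (Top i ?G) \<nu> \<noteq> 0 \<or> coeffx ?G \<nu> \<noteq> 0" using iff coefH by auto
    then show "profile n \<nu> x \<le> profile n \<mu> x"
      using \<nu> dom top_dominated_Top[OF dom i] by (auto simp: top_dominated_def)
  qed
  moreover have "coeffx (lagrange n ?\<mu>) \<rho> = 0"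
    if \<rho>: "is_comp n \<rho>" "profile n \<rho> = profile n ?\<mu>" "\<rho> \<noteq> ?\<mu>" "asc n ?\<mu> \<le> asc n \<rho>" for \<rho>
  proof -
    have "\<rho> \<noteq> \<mu>" using asc \<rho>(4) by auto
    then have "coeffx ?G \<rho> = 0" using tri0 \<rho> prof asc by simp
    \<comment> \<open>A swap loses at most one ascent, and \<open>\<rho>\<close> has at least one
      more than \<open>\<mu>\<close>.\<close>
    moreover have "coeffx ?G (\<rho> \<circ> ?s) = 0"
    proof (rule tri0)
      show "\<rho> \<circ> ?s \<noteq> \<mu>" using \<rho>(3) ss by metis
      show "asc n \<mu> \<le> asc n (\<rho> \<circ> ?s)"
        using asc_transpose_le[OF i, of "\<rho> \<circ> ?s"] \<rho>(4) asc by (simp add: ss)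
    qed (use \<rho> prof s in \<open>auto simp: is_comp_permute profile_permute\<close>)
    ultimately have "coeffx H \<rho> = 0"
      unfolding coefH using coeffx_Top_orbit[OF dom i \<rho>(1)] \<rho>(2) prof by simp
    then show ?thesis using iff by simp
  qed
  ultimately show ?thesis using iff leadH by (auto simp: triangular_def)
qed

lemma triangular_size_0:
  assumes "is_comp n \<mu>" "csize n \<mu> = 0"
  shows "triangular n \<mu>"
proof -
  have zero: "\<rho> = (\<lambda>_. 0)" if "is_comp n \<rho>" "csize n \<rho> = 0" for \<rho>
  proof
    fix x show "\<rho> x = 0" using that by (cases "x < n") (auto simp: csize_def is_comp_def)
  qed
  then have \<mu>: "\<mu> = (\<lambda>_. 0)" using assms by blast
  let ?G = "lagrange n \<mu>"
  have "keys ?G \<subseteq> {0}"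
  proof
    fix m assume "m \<in> keys ?G"
    then have "tdeg m = 0" using poly_in_lagrange[of n \<mu>] assms by (auto simp: poly_in_def in_keys_iff)
    then show "m \<in> {0}"
      by (auto simp: tdeg_def in_keys_iff intro: poly_mapping_eqI)
  qed
  then have "peval ?G (tilde n \<mu>) = lookup ?G 0"
    by (subst peval_superset[of "{0}"]) (auto simp: mon_eval_def)
  then have "lookup ?G 0 = 1" using assms by (simp add: peval_lagrange)
  then have "coeffx ?G \<mu> \<noteq> 0" by (simp add: coeffx_def \<mu>)
  moreover have "top_dominated n ?G \<mu>"
    using zero \<mu> assms unfolding top_dominated_def by auto
  moreover have "\<rho> = \<mu>" if "is_comp n \<rho>" "profile n \<rho> = profile n \<mu>" for \<rho>
    using zero[OF that(1)] \<mu> assms(2) that(2) by (simp flip: profile_0)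
  ultimately show ?thesis unfolding triangular_def by blast
qed

text \<open>Top monomials of \<open>lagrange n \<mu>\<close> are the \<open>k\<close>-fold raises of
  those for \<open>\<mu>0\<close>. If such a raise of \<open>\<nu>\<close> rearranges
  \<open>\<mu>\<close>, then \<open>\<nu>\<close> rearranges \<open>\<mu>0\<close> and begins with
  \<open>n - k\<close> zeros, which gives it at least as many ascents as \<open>\<mu>0\<close>;
  triangularity for \<open>\<mu>0\<close> leaves only \<open>\<nu> = \<mu>0\<close>.\<close>

lemma triangular_decreasing:
  assumes \<mu>: "is_comp n \<mu>" and dec: "\<And>i j. i \<le> j \<Longrightarrow> j < n \<Longrightarrow> \<mu> j \<le> \<mu> i"
    and pos: "csize n \<mu> > 0"
    and IH: "\<And>\<nu>. is_comp n \<nu> \<Longrightarrow> csize n \<nu> < csize n \<mu> \<Longrightarrow> triangular n \<nu>"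
  shows "triangular n \<mu>"
proof -
  have n: "0 < n" using pos by (cases n) (auto simp: csize_def)
  define k where "k = (LEAST j. \<mu> j = 0)"
  \<comment> \<open>The value \<open>0\<close> outside the range bounds \<open>k\<close> by
    \<open>n\<close> even if all parts are positive.\<close>
  have "\<mu> n = 0" using \<mu> by (simp add: is_comp_def)
  then have kn: "k \<le> n" and k0: "\<mu> k = 0"
    unfolding k_def by (auto intro: Least_le LeastI)
  have below: "\<mu> j > 0" if "j < k" for j using not_less_Least[of j "\<lambda>j. \<mu> j = 0"] that by (auto simp: k_def)
  have above: "\<mu> j = 0" if "k \<le> j" for j
    using dec[of k j] that k0 \<mu> by (cases "j < n") (auto simp: is_comp_def)
  define \<mu>0 where "\<mu>0 j = (if j < n - k then 0 else if j < n then \<mu> (j - (n - k)) - 1 else 0)" for j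
  have \<mu>0: "is_comp n \<mu>0" by (auto simp: \<mu>0_def is_comp_def)
  have rais: "(raise n 0 ^^ k) \<mu>0 = \<mu>"
    using below above kn by (auto simp: fun_eq_iff raises_apply \<mu>0_def)
  have size: "csize n \<mu> = csize n \<mu>0 + k" using csize_raises[OF n, of k \<mu>0] rais by simp
  have "k > 0"
  proof (rule ccontr)
    assume "\<not> k > 0"
    then have "csize n \<mu> = 0" using above by (simp add: csize_def)
    then show False using pos by simp
  qed
  then have tri0: "triangular n \<mu>0" using IH[OF \<mu>0] size by simp
  have coef: "coeffx (lagrange n \<mu>) \<rho> \<noteq> 0 \<longleftrightarrow>
      (\<exists>\<nu>. is_comp n \<nu> \<and> \<rho> = (raise n 0 ^^ k) \<nu> \<and> coeffx (lagrange n \<mu>0) \<nu> \<noteq> 0)"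
    if "is_comp n \<rho>" "csize n \<rho> = csize n \<mu>" for \<rho>
    using coeffx_lagrange_raises[OF n \<mu>0 that(1), of k] that(2) size rais by simp
  have prof: "profile n ((raise n 0 ^^ k) \<nu>) (Suc a) =
      (\<Sum>i<n. \<nu> i + (if n - k \<le> i then 1 else 0) - Suc a)" for \<nu> a
    unfolding profile_def by (rule sum_raises[OF kn, of "\<lambda>x. x - Suc a"])
  \<comment> \<open>Raised parts compensate the step from \<open>a\<close> to \<open>Suc a\<close>,
    and unraised zeros contribute nothing on either side.\<close>
  have prof_eq: "profile n ((raise n 0 ^^ k) \<nu>) (Suc a) = profile n \<nu> a"
    if "\<And>i. i < n - k \<Longrightarrow> \<nu> i = 0" for \<nu> a
    unfolding prof unfolding profile_def by (rule sum.cong) (use that in auto)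
  have prof\<mu>: "profile n \<mu> (Suc a) = profile n \<mu>0 a" for a
    using prof_eq[of \<mu>0 a] rais by (simp add: \<mu>0_def)
  have "coeffx (lagrange n \<mu>) \<mu> \<noteq> 0"
    using coef[OF \<mu>] \<mu>0 rais tri0 by (auto simp: triangular_def)
  moreover have "top_dominated n (lagrange n \<mu>) \<mu>"
    unfolding top_dominated_def
  proof (intro allI impI, elim conjE)
    fix \<rho> a assume \<rho>: "is_comp n \<rho>" "csize n \<rho> = csize n \<mu>" "coeffx (lagrange n \<mu>) \<rho> \<noteq> 0"
    then obtain \<nu> where \<nu>: "is_comp n \<nu>" "\<rho> = (raise n 0 ^^ k) \<nu>" "coeffx (lagrange n \<mu>0) \<nu> \<noteq> 0"
      using coef by blast
    show "profile n \<rho> a \<le> profile n \<mu> a"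
    proof (cases a)
      case 0
      then show ?thesis using \<rho> by (simp add: profile_0)
    next
      case (Suc b)
      have "profile n \<rho> a \<le> profile n \<nu> b"
        unfolding Suc \<nu>(2) prof unfolding profile_def by (rule sum_mono) auto
      also have "\<dots> \<le> profile n \<mu>0 b"
        using tri0 \<nu> \<rho>(2) size csize_raises[OF n, of k \<nu>]
        by (auto simp: triangular_def top_dominated_def)
      finally show ?thesis using Suc prof\<mu> by simp
    qed
  qed
  moreover have "coeffx (lagrange n \<mu>) \<rho> = 0"
    if \<rho>: "is_comp n \<rho>" "profile n \<rho> = profile n \<mu>" "\<rho> \<noteq> \<mu>" for \<rho>
  proof (rule ccontr)
    assume nz: "coeffx (lagrange n \<mu>) \<rho> \<noteq> 0"
    have "csize n \<rho> = csize n \<mu>" using \<rho>(2) by (simp flip: profile_0)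
    then obtain \<nu> where \<nu>: "is_comp n \<nu>" "\<rho> = (raise n 0 ^^ k) \<nu>" "coeffx (lagrange n \<mu>0) \<nu> \<noteq> 0"
      using coef \<rho>(1) nz by blast
    \<comment> \<open>By its profile \<open>\<rho>\<close> has exactly \<open>k\<close> nonzero
      parts; its first \<open>k\<close> parts are raised and hence nonzero, so there are no
      others.\<close>
    have "{j. j < n \<and> \<mu> j > 0} = {..<k}"
    proof (intro equalityI subsetI)
      fix j assume "j \<in> {j. j < n \<and> \<mu> j > 0}"
      then show "j \<in> {..<k}" using above[of j] by (cases "j < k") auto
    qed (use below kn in auto)
    then have "card {j. j < n \<and> \<rho> j > 0} = k"
      using card_pos_profile[of n \<rho>] card_pos_profile[of n \<mu>] \<rho>(2) by simp
    moreover have "{..<k} \<subseteq> {j. j < n \<and> \<rho> j > 0}"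
      using \<nu>(2) kn by (auto simp: raises_apply)
    ultimately have eq: "{..<k} = {j. j < n \<and> \<rho> j > 0}"
      by (intro card_subset_eq) auto
    have \<rho>0: "\<rho> j = 0" if "k \<le> j" "j < n" for j
      using equalityD2[OF eq] that by (auto simp: subset_eq)
    have \<nu>0: "\<nu> i = 0" if "i < n - k" for i
      using \<rho>0[of "i + k"] that \<nu>(2) by (simp add: raises_apply kn)
    have prof\<nu>: "profile n \<nu> = profile n \<mu>0"
    proof
      fix a
      have "profile n \<nu> a = profile n \<rho> (Suc a)" using prof_eq[of \<nu> a] \<nu>0 \<nu>(2) by simp
      then show "profile n \<nu> a = profile n \<mu>0 a" using \<rho>(2) prof\<mu> by simp
    qed
    have cards: "card {j. j < n \<and> \<nu> j > 0} = card {j. j < n \<and> \<mu>0 j > 0}"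
      using card_pos_profile[of n \<nu>] card_pos_profile[of n \<mu>0] prof\<nu> by simp
    \<comment> \<open>The last \<open>k\<close> parts of \<open>\<mu>0\<close> decrease, so each of
      its ascents starts in the block of zeros.\<close>
    have "{(i, j). i < j \<and> j < n \<and> \<mu>0 i < \<mu>0 j} \<subseteq> {..<n - k} \<times> {j. j < n \<and> \<mu>0 j > 0}"
    proof
      fix p assume "p \<in> {(i, j). i < j \<and> j < n \<and> \<mu>0 i < \<mu>0 j}"
      then obtain i j where ij: "p = (i, j)" "i < j" "j < n" "\<mu>0 i < \<mu>0 j" by auto
      have "i < n - k"
      proof (rule ccontr)
        assume i: "\<not> i < n - k"
        have "\<mu> (j - (n - k)) \<le> \<mu> (i - (n - k))"
          using ij by (intro dec) auto
        moreover have "\<mu>0 i = \<mu> (i - (n - k)) - 1" "\<mu>0 j = \<mu> (j - (n - k)) - 1"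
          using ij i by (auto simp: \<mu>0_def)
        ultimately show False using ij by linarith
      qed
      then show "p \<in> {..<n - k} \<times> {j. j < n \<and> \<mu>0 j > 0}" using ij by auto
    qed
    then have "asc n \<mu>0 \<le> card ({..<n - k} \<times> {j. j < n \<and> \<mu>0 j > 0})"
      unfolding asc_def by (intro card_mono) auto
    also have "\<dots> = card ({..<n - k} \<times> {j. j < n \<and> \<nu> j > 0})"
      by (simp add: card_cartesian_product cards)
    \<comment> \<open>In \<open>\<nu>\<close>, every zero of the initial block forms an ascent with
      every positive part.\<close>
    also have "\<dots> \<le> asc n \<nu>"
      unfolding asc_def
    proof (intro card_mono subsetI)
      fix p assume "p \<in> {..<n - k} \<times> {j. j < n \<and> \<nu> j > 0}"
      then obtain i j where p: "p = (i, j)" "i < n - k" "j < n" "\<nu> j > 0" by auto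
      then have "i < j" using \<nu>0[of j] by (cases "j < n - k") auto
      then show "p \<in> {(i, j). i < j \<and> j < n \<and> \<nu> i < \<nu> j}" using p \<nu>0 by auto
    qed auto
    finally have "asc n \<mu>0 \<le> asc n \<nu>" .
    then have "\<nu> = \<mu>0" using tri0 \<nu>(1,3) prof\<nu> unfolding triangular_def by blast
    then show False using \<nu>(2) rais \<rho>(3) by simp
  qed
  ultimately show ?thesis unfolding triangular_def by blast
qed

lemma decreasing_if_no_ascent:
  fixes \<kappa> :: "nat \<Rightarrow> nat"
  assumes "\<not> (\<exists>i. Suc i < n \<and> \<kappa> i < \<kappa> (Suc i))"
  shows "i \<le> j \<Longrightarrow> j < n \<Longrightarrow> \<kappa> j \<le> \<kappa> i"
proof (induction j rule: dec_induct)
  case (step j)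
  have "\<not> \<kappa> j < \<kappa> (Suc j)" using assms step.prems by blast
  then show ?case using step.IH step.prems by linarith
qed simp

text \<open>Induction on ascents within one size: undoing an adjacent ascent removes one, and
  without adjacent ascents the composition is decreasing.\<close>

lemma triangular_step:
  assumes smaller: "\<And>\<nu>. is_comp n \<nu> \<Longrightarrow> csize n \<nu> < d \<Longrightarrow> triangular n \<nu>"
  shows "is_comp n \<kappa> \<Longrightarrow> csize n \<kappa> = d \<Longrightarrow> triangular n \<kappa>"
proof (induction "asc n \<kappa>" arbitrary: \<kappa> rule: less_induct)
  case less
  show ?case
  proof (cases "\<exists>i. Suc i < n \<and> \<kappa> i < \<kappa> (Suc i)")
    case True
    then obtain i where i: "Suc i < n" "\<kappa> i < \<kappa> (Suc i)" by blast
    define \<kappa>' where "\<kappa>' = \<kappa> \<circ> Transposition.transpose i (Suc i)"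
    have \<kappa>: "\<kappa> = \<kappa>' \<circ> Transposition.transpose i (Suc i)" by (simp add: \<kappa>'_def comp_assoc)
    have s: "Transposition.transpose i (Suc i) permutes {..<n}" by (rule transpose_permutes[OF i(1)])
    have comp: "is_comp n \<kappa>'" unfolding \<kappa>'_def by (rule is_comp_permute[OF s less.prems(1)])
    have size: "csize n \<kappa>' = d" unfolding \<kappa>'_def csize_permute[OF s] by (rule less.prems(2))
    have desc: "\<kappa>' i > \<kappa>' (Suc i)" using i(2) by (simp add: \<kappa>'_def)
    have "asc n \<kappa>' < asc n \<kappa>" using asc_transpose'[OF i] by (simp add: \<kappa>'_def)
    then have "triangular n \<kappa>'" using comp size by (rule less.hyps)
    then show ?thesis unfolding \<kappa> using comp i(1) desc by (rule triangular_transpose)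
  next
    case False
    show ?thesis
    proof (cases "d = 0")
      case True
      then show ?thesis using triangular_size_0 less.prems by simp
    next
      case pos: False
      show ?thesis
        by (rule triangular_decreasing[OF less.prems(1) decreasing_if_no_ascent[OF False]])
          (use pos less.prems(2) smaller in auto)
    qed
  qed
qed

theorem triangular: "is_comp n \<mu> \<Longrightarrow> triangular n \<mu>"
proof (induction "csize n \<mu>" arbitrary: \<mu> rule: less_induct)
  case less
  show ?case
  proof (rule triangular_step[OF _ less.prems refl])
    show "triangular n \<nu>" if "is_comp n \<nu>" "csize n \<nu> < csize n \<mu>" for \<nu>
      using that(2,1) by (rule less.hyps)
  qed
qed

section \<open>Minimal coset representatives\<close>

definition word_perm :: "nat list \<Rightarrow> nat \<Rightarrow> nat" where
  "word_perm w = foldr (\<lambda>i \<tau>. Transposition.transpose i (Suc i) \<circ> \<tau>) w id"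

lemma word_perm_Nil: "word_perm [] = id"
  by (simp add: word_perm_def)

lemma word_perm_Cons: "word_perm (i # w) = Transposition.transpose i (Suc i) \<circ> word_perm w"
  by (simp add: word_perm_def)

lemma word_perm_permutes: "\<forall>i\<in>set w. Suc i < n \<Longrightarrow> word_perm w permutes {..<n}"
proof (induction w)
  case Nil
  show ?case unfolding word_perm_Nil by (rule permutes_id)
next
  case (Cons i w)
  then show ?case unfolding word_perm_Cons by (intro permutes_compose transpose_permutes) auto
qed

lemma act_transpose_comp:
  assumes "\<tau> permutes {..<n}"
  shows "act (Transposition.transpose i (Suc i) \<circ> \<tau>) lam = act \<tau> lam \<circ> Transposition.transpose i (Suc i)"
  using assms by (simp add: act_def o_inv_distrib permutes_bij comp_assoc)

lemma asc_act_word_le: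
  assumes "\<forall>i\<in>set w. Suc i < n" "asc n lam = 0"
  shows "asc n (act (word_perm w) lam) \<le> length w"
  using assms(1)
proof (induction w)
  case Nil
  then show ?case using assms(2) by (simp add: act_def word_perm_Nil)
next
  case (Cons i w)
  then have eq: "act (word_perm (i # w)) lam = act (word_perm w) lam \<circ> Transposition.transpose i (Suc i)"
    unfolding word_perm_Cons by (intro act_transpose_comp[OF word_perm_permutes]) auto
  have "asc n (act (word_perm w) lam) \<le> length w" using Cons by simp
  moreover have "asc n (act (word_perm w) lam \<circ> Transposition.transpose i (Suc i)) \<le>
      Suc (asc n (act (word_perm w) lam))"
    by (rule asc_transpose_le) (use Cons.prems in simp)
  ultimately show ?case unfolding eq length_Cons by linarith
qed

text \<open>Only the pair of positions carrying the values \<open>i\<close> and \<open>Suc i\<close>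
  can become a new inversion.\<close>

lemma inv_count_transpose_le:
  assumes \<sigma>: "\<sigma> permutes {..<n}"
  shows "inv_count n (Transposition.transpose i (Suc i) \<circ> \<sigma>) \<le> Suc (inv_count n \<sigma>)"
proof -
  let ?s = "Transposition.transpose i (Suc i)"
  let ?I = "{(a, b). a < b \<and> b < n \<and> \<sigma> a > \<sigma> b}"
  have "{(a, b). a < b \<and> b < n \<and> (?s \<circ> \<sigma>) a > (?s \<circ> \<sigma>) b} \<subseteq> insert (inv \<sigma> i, inv \<sigma> (Suc i)) ?I"
  proof
    fix p assume "p \<in> {(a, b). a < b \<and> b < n \<and> (?s \<circ> \<sigma>) a > (?s \<circ> \<sigma>) b}"
    then obtain a b where p: "p = (a, b)" "a < b" "b < n" "?s (\<sigma> a) > ?s (\<sigma> b)" by auto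
    show "p \<in> insert (inv \<sigma> i, inv \<sigma> (Suc i)) ?I"
    proof (cases "\<sigma> a > \<sigma> b")
      case False
      moreover have "\<sigma> a \<noteq> \<sigma> b" using p(2) permutes_inj[OF \<sigma>] by (auto dest: injD)
      ultimately have "\<sigma> a = i" "\<sigma> b = Suc i"
        using p(4) by (auto simp: Transposition.transpose_def split: if_splits)
      then have "a = inv \<sigma> i" "b = inv \<sigma> (Suc i)"
        using permutes_inverses(2)[OF \<sigma>] by metis+
      then show ?thesis using p(1) by simp
    qed (use p in auto)
  qed
  then have "inv_count n (?s \<circ> \<sigma>) \<le> card (insert (inv \<sigma> i, inv \<sigma> (Suc i)) ?I)"
    unfolding inv_count_def by (intro card_mono) auto
  also have "\<dots> \<le> Suc (inv_count n \<sigma>)"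
    unfolding inv_count_def by (simp add: card_insert_if)
  finally show ?thesis .
qed

lemma inv_count_word_le: "\<forall>i\<in>set w. Suc i < n \<Longrightarrow> inv_count n (word_perm w) \<le> length w"
proof (induction w)
  case Nil
  have "{(i, j). i < j \<and> j < n \<and> id i > (id j :: nat)} = {}" by auto
  then show ?case unfolding inv_count_def word_perm_Nil by simp
next
  case (Cons i w)
  have "inv_count n (word_perm (i # w)) \<le> Suc (inv_count n (word_perm w))"
    unfolding word_perm_Cons by (rule inv_count_transpose_le[OF word_perm_permutes]) (use Cons.prems in auto)
  moreover have "inv_count n (word_perm w) \<le> length w" using Cons by simp
  ultimately show ?case by simp
qed

section \<open>The orbit of a partition and its shortest permutations\<close>

context
  fixes n :: nat and lam :: "nat \<Rightarrow> nat"
  assumes part: "is_partition n lam"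
begin

lemma part_dec: "i \<le> j \<Longrightarrow> j < n \<Longrightarrow> lam j \<le> lam i"
  using part by (auto simp: is_partition_def)

lemma part_comp: "is_comp n lam"
  using part by (simp add: is_partition_def)

lemma asc_partition: "asc n lam = 0"
proof -
  have "\<not> (i < j \<and> j < n \<and> lam i < lam j)" for i j
    using part_dec[of i j] by auto
  then have "{(i, j). i < j \<and> j < n \<and> lam i < lam j} = {}" by blast
  then show ?thesis by (simp add: asc_def)
qed

text \<open>An inversion \<open>(i, j)\<close> of \<open>\<sigma>\<close> with \<open>lam\<^sub>i > lam\<^sub>j\<close> is the same thing as an ascent of \<open>\<sigma> lam\<close>; the
  other inversions lie inside the blocks of equal parts of \<open>lam\<close>.\<close>

lemma
  assumes \<sigma>: "\<sigma> permutes {..<n}"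
  shows asc_le_inv_count: "asc n (act \<sigma> lam) \<le> inv_count n \<sigma>"
    and inv_count_le_asc_stable: "inv_count n \<sigma> \<le> asc n (act \<sigma> lam) \<Longrightarrow> i < j \<Longrightarrow> j < n \<Longrightarrow>
      lam i = lam j \<Longrightarrow> \<sigma> i < \<sigma> j"
proof -
  let ?A = "{(p, q). p < q \<and> q < n \<and> act \<sigma> lam p < act \<sigma> lam q}"
  let ?I = "{(i, j). i < j \<and> j < n \<and> \<sigma> i > \<sigma> j}"
  let ?f = "\<lambda>(p, q). (inv \<sigma> q, inv \<sigma> p)"
  have inv: "\<sigma> (inv \<sigma> p) = p" "inv \<sigma> (\<sigma> p) = p" for p
    using permutes_inverses[OF \<sigma>] by auto
  have bound: "inv \<sigma> p < n" if "p < n" for p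
    using permutes_in_image[OF permutes_inv[OF \<sigma>], of p] that by simp
  have sub: "?f ` ?A \<subseteq> {(i, j). (i, j) \<in> ?I \<and> lam i > lam j}"
  proof
    fix x assume "x \<in> ?f ` ?A"
    then obtain p q where x: "x = (inv \<sigma> q, inv \<sigma> p)" "p < q" "q < n" "lam (inv \<sigma> p) < lam (inv \<sigma> q)"
      by (auto simp: act_def)
    moreover have "inv \<sigma> q < inv \<sigma> p"
      using part_dec[of "inv \<sigma> p" "inv \<sigma> q"] x bound[of q] by (meson not_le)
    ultimately show "x \<in> {(i, j). (i, j) \<in> ?I \<and> lam i > lam j}"
      using bound[of p] by (auto simp: inv)
  qed
  have "inj_on ?f ?A"
  proof (rule inj_onI)
    fix x y assume "?f x = ?f y"
    then show "x = y" by (cases x; cases y) (metis case_prod_conv inv(1) prod.inject)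
  qed
  then have card: "asc n (act \<sigma> lam) = card (?f ` ?A)" by (simp add: asc_def card_image)
  also have "\<dots> \<le> card ?I" by (rule card_mono) (use sub in auto)
  finally show "asc n (act \<sigma> lam) \<le> inv_count n \<sigma>" by (simp add: inv_count_def)
  assume le: "inv_count n \<sigma> \<le> asc n (act \<sigma> lam)" and ij: "i < j" "j < n" "lam i = lam j"
  show "\<sigma> i < \<sigma> j"
  proof (rule ccontr)
    assume "\<not> \<sigma> i < \<sigma> j"
    moreover have "\<sigma> i \<noteq> \<sigma> j" using inv(2) ij(1) by (metis less_irrefl)
    ultimately have "(i, j) \<in> ?I" using ij by simp
    \<comment> \<open>An inversion inside a block of equal parts comes from no ascent, which makes
      the inclusion strict.\<close>
    moreover have "(i, j) \<notin> ?f ` ?A" using sub ij(3) by auto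
    moreover have "?f ` ?A \<subseteq> ?I" using sub by blast
    ultimately have "?f ` ?A \<subset> ?I" by blast
    then have "card (?f ` ?A) < card ?I" by (rule psubset_card_mono[rotated]) simp
    then show False using le card by (simp add: inv_count_def)
  qed
qed

text \<open>\<open>inv \<tau> \<circ> \<sigma>\<close> preserves the blocks of equal parts of
  \<open>lam\<close> and is increasing on each, hence the identity.\<close>

lemma stable_unique:
  assumes \<sigma>: "\<sigma> permutes {..<n}" and \<tau>: "\<tau> permutes {..<n}" and eq: "act \<sigma> lam = act \<tau> lam"
    and st\<sigma>: "\<And>i j. i < j \<Longrightarrow> j < n \<Longrightarrow> lam i = lam j \<Longrightarrow> \<sigma> i < \<sigma> j"
    and st\<tau>: "\<And>i j. i < j \<Longrightarrow> j < n \<Longrightarrow> lam i = lam j \<Longrightarrow> \<tau> i < \<tau> j"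
  shows "\<sigma> = \<tau>"
proof -
  define \<pi> where "\<pi> = inv \<tau> \<circ> \<sigma>"
  have \<pi>: "\<pi> permutes {..<n}" unfolding \<pi>_def by (intro permutes_compose permutes_inv \<sigma> \<tau>)
  have \<pi>n: "\<pi> i < n \<longleftrightarrow> i < n" for i using permutes_in_image[OF \<pi>, of i] by simp
  have \<tau>\<pi>: "\<tau> (\<pi> i) = \<sigma> i" for i using permutes_inverses(1)[OF \<tau>] by (simp add: \<pi>_def)
  have block: "lam (\<pi> i) = lam i" for i
    using fun_cong[OF eq, of "\<sigma> i"] permutes_inverses(2)[OF \<sigma>, of i] by (simp add: act_def \<pi>_def)
  have inj: "\<pi> i = \<pi> j \<longleftrightarrow> i = j" for i j using permutes_inj[OF \<pi>] by (auto dest: injD)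
  have mono: "\<pi> i < \<pi> j" if "i < j" "j < n" "lam i = lam j" for i j
  proof (rule ccontr)
    assume "\<not> \<pi> i < \<pi> j"
    then have "\<pi> j < \<pi> i" using inj[of i j] that(1) by linarith
    then have "\<tau> (\<pi> j) < \<tau> (\<pi> i)" using that \<pi>n block by (intro st\<tau>) auto
    then show False using st\<sigma>[OF that] \<tau>\<pi> by simp
  qed
  \<comment> \<open>If \<open>i\<close> is hit from \<open>k > i\<close> in its block, monotonicity
    forces \<open>\<pi> i < i\<close>, but that value is already fixed.\<close>
  have "\<pi> i = i" for i
  proof (induction i rule: less_induct)
    case (less i)
    show ?case
    proof (cases "i < n")
      case True
      obtain k where k: "\<pi> k = i" using permutes_surj[OF \<pi>] by (metis surjD)
      have kn: "k < n" using \<pi>n[of k] k True by simp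
      have "lam k = lam i" using block[of k] k by simp
      show ?thesis
      proof (cases k i rule: linorder_cases)
        case less
        then show ?thesis using less.IH[of k] k by simp
      next
        case equal
        then show ?thesis using k by simp
      next
        case greater
        then have "\<pi> i < i" using mono[of i k] k kn \<open>lam k = lam i\<close> by simp
        then show ?thesis using less.IH[of "\<pi> i"] inj[of "\<pi> i" i] by simp
      qed
    qed (use \<pi> in \<open>auto simp: permutes_def\<close>)
  qed
  then show ?thesis using \<tau>\<pi> by (auto simp: fun_eq_iff)
qed

lemma Sn_permute:
  assumes "\<mu> \<in> Sn n lam" "\<tau> permutes {..<n}"
  shows "\<mu> \<circ> \<tau> \<in> Sn n lam"
proof -
  obtain \<sigma> where \<sigma>: "\<sigma> permutes {..<n}" "\<mu> = lam \<circ> inv \<sigma>" using assms(1) by (auto simp: Sn_def act_def)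
  have "inv (inv \<tau> \<circ> \<sigma>) = inv \<sigma> \<circ> \<tau>"
    using o_inv_distrib[of "inv \<tau>" \<sigma>] permutes_bij[OF \<sigma>(1)] permutes_bij[OF assms(2)]
    by (simp add: bij_imp_bij_inv inv_inv_eq)
  then have "\<mu> \<circ> \<tau> = act (inv \<tau> \<circ> \<sigma>) lam" by (simp add: act_def \<sigma>(2) comp_assoc)
  then show ?thesis
    using permutes_compose[OF \<sigma>(1) permutes_inv[OF assms(2)]] by (auto simp: Sn_def)
qed

lemma Sn_props:
  assumes "\<mu> \<in> Sn n lam"
  shows "is_comp n \<mu>" "profile n \<mu> = profile n lam" "csize n \<mu> = csize n lam"
proof -
  obtain \<sigma> where \<sigma>: "\<sigma> permutes {..<n}" "\<mu> = lam \<circ> inv \<sigma>" using assms by (auto simp: Sn_def act_def)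
  note p = permutes_inv[OF \<sigma>(1)]
  show "is_comp n \<mu>" "profile n \<mu> = profile n lam" "csize n \<mu> = csize n lam"
    unfolding \<sigma>(2) using is_comp_permute[OF p part_comp] profile_permute[OF p] csize_permute[OF p] by auto
qed

lemma lam_in_Sn: "lam \<in> Sn n lam"
proof -
  have "lam = act id lam" by (simp add: act_def)
  then show ?thesis unfolding Sn_def using permutes_id by blast
qed

lemma finite_Sn: "finite (Sn n lam)"
proof -
  have "Sn n lam = (\<lambda>\<sigma>. act \<sigma> lam) ` {\<sigma>. \<sigma> permutes {..<n}}" by (auto simp: Sn_def)
  then show ?thesis by (simp add: finite_permutations)
qed

text \<open>For decreasing compositions the sets of positions with part above \<open>a\<close> are
  comparable by inclusion, and those of two rearrangements have equal size.\<close>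

lemma Sn_decreasing:
  assumes "\<mu> \<in> Sn n lam" and dec: "\<And>i j. i \<le> j \<Longrightarrow> j < n \<Longrightarrow> \<mu> j \<le> \<mu> i"
  shows "\<mu> = lam"
proof -
  obtain \<sigma> where \<sigma>: "\<sigma> permutes {..<n}" "\<mu> = lam \<circ> inv \<sigma>" using assms by (auto simp: Sn_def act_def)
  have \<mu>\<sigma>: "\<mu> (\<sigma> j) = lam j" for j using permutes_inverses(2)[OF \<sigma>(1)] by (simp add: \<sigma>(2))
  have \<sigma>n: "\<sigma> j < n \<longleftrightarrow> j < n" for j using permutes_in_image[OF \<sigma>(1), of j] by simp
  have eq: "{j. j < n \<and> \<mu> j > a} = {j. j < n \<and> lam j > a}" (is "?S = ?T") for a
  proof -
    have "\<sigma> ` ?T = ?S"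
    proof (intro equalityI subsetI)
      fix j assume "j \<in> ?S"
      moreover obtain k where "j = \<sigma> k" using permutes_surj[OF \<sigma>(1)] by (metis surjD)
      ultimately show "j \<in> \<sigma> ` ?T" using \<mu>\<sigma> \<sigma>n by auto
    qed (use \<mu>\<sigma> \<sigma>n in auto)
    then have card: "card ?S = card ?T"
      using card_image[OF inj_on_subset[OF permutes_inj[OF \<sigma>(1)]], of ?T] by simp
    have "?S \<subseteq> ?T \<or> ?T \<subseteq> ?S"
    proof (rule ccontr)
      assume "\<not> ?thesis"
      then obtain x y where "x \<in> ?S" "x \<notin> ?T" "y \<in> ?T" "y \<notin> ?S" by blast
      then show False using dec[of x y] dec[of y x] part_dec[of x y] part_dec[of y x]
        by (cases x y rule: le_cases) auto
    qed
    then show ?thesis using card card_subset_eq[of ?T ?S] card_subset_eq[of ?S ?T] by auto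
  qed
  show ?thesis
  proof
    fix j
    show "\<mu> j = lam j"
    proof (cases "j < n")
      case True
      have "\<mu> j > a \<longleftrightarrow> lam j > a" for a using eq[of a] True by blast
      then show ?thesis by (metis linorder_neqE_nat less_irrefl)
    next
      case False
      then show ?thesis using Sn_props(1)[OF assms(1)] part_comp by (simp add: is_comp_def)
    qed
  qed
qed

text \<open>Sorting by adjacent exchanges removes one ascent per letter until the partition is
  reached.\<close>

lemma Sn_word:
  assumes "\<mu> \<in> Sn n lam"
  shows "\<exists>w. (\<forall>i\<in>set w. Suc i < n) \<and> act (word_perm w) lam = \<mu> \<and> length w = asc n \<mu>"
  using assms
proof (induction "asc n \<mu>" arbitrary: \<mu> rule: less_induct)
  case less
  show ?case
  proof (cases "\<exists>i. Suc i < n \<and> \<mu> i < \<mu> (Suc i)")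
    case True
    then obtain i where i: "Suc i < n" "\<mu> i < \<mu> (Suc i)" by blast
    define \<nu> where "\<nu> = \<mu> \<circ> Transposition.transpose i (Suc i)"
    have "\<nu> \<in> Sn n lam" unfolding \<nu>_def by (rule Sn_permute[OF less.prems transpose_permutes[OF i(1)]])
    moreover have asc: "asc n \<mu> = Suc (asc n \<nu>)" unfolding \<nu>_def by (rule asc_transpose'[OF i])
    ultimately obtain w where w: "\<forall>i\<in>set w. Suc i < n" "act (word_perm w) lam = \<nu>" "length w = asc n \<nu>"
      using less.hyps[of \<nu>] by auto
    have "act (word_perm (i # w)) lam = \<nu> \<circ> Transposition.transpose i (Suc i)"
      unfolding word_perm_Cons act_transpose_comp[OF word_perm_permutes[OF w(1)]] w(2) ..
    also have "\<dots> = \<mu>" by (simp add: \<nu>_def comp_assoc)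
    finally show ?thesis using w i asc by (intro exI[of _ "i # w"]) simp
  next
    case False
    then have "\<mu> = lam" using Sn_decreasing[OF less.prems] decreasing_if_no_ascent[OF False] by blast
    then show ?thesis by (intro exI[of _ "[]"]) (simp add: act_def asc_partition word_perm_Nil)
  qed
qed

text \<open>The sorting word attains the lower bound \<open>asc n \<mu>\<close> on inversions. Any
  other minimiser also attains it, hence is increasing on blocks and equal by
  \<open>stable_unique\<close>; so the \<open>THE\<close> in \<open>sigma_of\<close> is
  meaningful.\<close>

lemma sigma_of_reduced_word:
  assumes "\<mu> \<in> Sn n lam"
  shows "\<exists>w. reduced_word n (sigma_of n lam \<mu>) w"
    and "reduced_word n (sigma_of n lam \<mu>) w \<Longrightarrow> act (word_perm w) lam = \<mu> \<and> length w = asc n \<mu>"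
proof -
  obtain v where v: "\<forall>i\<in>set v. Suc i < n" "act (word_perm v) lam = \<mu>" "length v = asc n \<mu>"
    using Sn_word[OF assms] by blast
  let ?\<sigma> = "word_perm v"
  have perm: "?\<sigma> permutes {..<n}" by (rule word_perm_permutes[OF v(1)])
  have count: "inv_count n ?\<sigma> = asc n \<mu>"
    using inv_count_word_le[OF v(1)] asc_le_inv_count[OF perm] v by simp
  have "sigma_of n lam \<mu> = ?\<sigma>"
    unfolding sigma_of_def
  proof (rule the_equality)
    have "inv_count n ?\<sigma> \<le> inv_count n \<tau>" if "\<tau> permutes {..<n}" "act \<tau> lam = \<mu>" for \<tau>
      using asc_le_inv_count[OF that(1)] that(2) count by simp
    then show "?\<sigma> permutes {..<n} \<and> act ?\<sigma> lam = \<mu> \<and>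
        (\<forall>\<tau>. \<tau> permutes {..<n} \<and> act \<tau> lam = \<mu> \<longrightarrow> inv_count n ?\<sigma> \<le> inv_count n \<tau>)"
      using perm v(2) by blast
    fix \<sigma> assume \<sigma>: "\<sigma> permutes {..<n} \<and> act \<sigma> lam = \<mu> \<and>
        (\<forall>\<tau>. \<tau> permutes {..<n} \<and> act \<tau> lam = \<mu> \<longrightarrow> inv_count n \<sigma> \<le> inv_count n \<tau>)"
    then have "inv_count n \<sigma> \<le> inv_count n ?\<sigma>" using perm v(2) by blast
    then have min: "inv_count n \<sigma> \<le> asc n (act \<sigma> lam)" "inv_count n ?\<sigma> \<le> asc n (act ?\<sigma> lam)"
      using count \<sigma> v(2) by simp_all
    have perm': "\<sigma> permutes {..<n}" using \<sigma> by blast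
    have "act \<sigma> lam = act ?\<sigma> lam" using \<sigma> v(2) by simp
    then show "\<sigma> = ?\<sigma>"
      by (rule stable_unique[OF perm' perm])
        (fact inv_count_le_asc_stable[OF perm' min(1)] inv_count_le_asc_stable[OF perm min(2)])+
  qed
  then show "\<exists>w. reduced_word n (sigma_of n lam \<mu>) w"
    and "reduced_word n (sigma_of n lam \<mu>) w \<Longrightarrow> act (word_perm w) lam = \<mu> \<and> length w = asc n \<mu>"
    using v count by (auto simp: reduced_word_def simp flip: word_perm_def)
qed

section \<open>The polynomials \<open>f\<^sup>*\<^sub>\<mu>\<close>\<close>

lemma Estar_eq: "Estar n lam = Cst (1 / coeffx (lagrange n lam) lam) * lagrange n lam"
  unfolding Estar_def
proof (rule the_equality)
  let ?c = "coeffx (lagrange n lam) lam"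
  have c: "?c \<noteq> 0" using triangular[OF part_comp] by (simp add: triangular_def)
  show "in_vars n (Cst (1 / ?c) * lagrange n lam) \<and> deg_le (Cst (1 / ?c) * lagrange n lam) (csize n lam) \<and>
    coeffx (Cst (1 / ?c) * lagrange n lam) lam = 1 \<and>
    (\<forall>\<nu>. is_comp n \<nu> \<and> csize n \<nu> \<le> csize n lam \<and> \<nu> \<noteq> lam \<longrightarrow>
      peval (Cst (1 / ?c) * lagrange n lam) (tilde n \<nu>) = 0)"
    using poly_in_Cst_mult[OF poly_in_lagrange[of n lam], of "1 / ?c"] c
    by (simp add: poly_in_iff peval_mult peval_lagrange)
  fix g assume "in_vars n g \<and> deg_le g (csize n lam) \<and> coeffx g lam = 1 \<and>
    (\<forall>\<nu>. is_comp n \<nu> \<and> csize n \<nu> \<le> csize n lam \<and> \<nu> \<noteq> lam \<longrightarrow> peval g (tilde n \<nu>) = 0)"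
  then have g: "poly_in {..<n} (Suc (csize n lam)) g" "coeffx g lam = 1"
    "\<And>\<nu>. is_comp n \<nu> \<Longrightarrow> csize n \<nu> \<le> csize n lam \<Longrightarrow> \<nu> \<noteq> lam \<Longrightarrow> peval g (tilde n \<nu>) = 0"
    by (auto simp: poly_in_iff)
  let ?v = "peval g (tilde n lam)"
  have eq: "g = Cst ?v * lagrange n lam" by (rule lagrange_unique[OF part_comp g(1,3)])
  have "?v * ?c = 1" using arg_cong[OF eq, of "\<lambda>p. coeffx p lam"] g(2) by simp
  then have "?v = 1 / ?c" using c by (simp add: field_simps)
  then show "g = Cst (1 / ?c) * lagrange n lam" using eq by simp
qed

text \<open>The conditions of \<open>fchar\<close> strengthened by dominance, the hypothesis under
  which \<open>coeffx_Top_orbit\<close> lets the induction pass through \<open>Top\<close>.\<close>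

definition fstar_like :: "mpoly \<Rightarrow> (nat \<Rightarrow> nat) \<Rightarrow> bool" where
  "fstar_like g \<mu> \<longleftrightarrow> poly_in {..<n} (Suc (csize n lam)) g \<and>
     (\<forall>\<nu>. is_comp n \<nu> \<and> csize n \<nu> \<le> csize n lam \<and> \<nu> \<notin> Sn n lam \<longrightarrow> peval g (tilde n \<nu>) = 0) \<and>
     (\<forall>\<tau>\<in>Sn n lam. coeffx g \<tau> = (if \<tau> = \<mu> then 1 else 0)) \<and> top_dominated n g lam"

lemma fstar_like_fchar: "fstar_like g \<mu> \<Longrightarrow> \<mu> \<in> Sn n lam \<Longrightarrow> fchar n lam \<mu> g"
  using Sn_props(3)[of \<mu>] by (simp add: fstar_like_def fchar_def poly_in_iff)

lemma fstar_like_Estar: "fstar_like (Estar n lam) lam"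
proof -
  let ?c = "coeffx (lagrange n lam) lam"
  have tri: "?c \<noteq> 0" "top_dominated n (lagrange n lam) lam"
    "\<And>\<rho>. is_comp n \<rho> \<Longrightarrow> profile n \<rho> = profile n lam \<Longrightarrow> \<rho> \<noteq> lam \<Longrightarrow> coeffx (lagrange n lam) \<rho> = 0"
    using triangular[OF part_comp] by (auto simp: triangular_def asc_partition)
  have "coeffx (Estar n lam) \<tau> = (if \<tau> = lam then 1 else 0)" if "\<tau> \<in> Sn n lam" for \<tau>
    unfolding Estar_eq using tri(1,3) Sn_props[OF that] by simp
  moreover have "top_dominated n (Estar n lam) lam"
    unfolding Estar_eq using tri(2) by (simp add: top_dominated_def)
  moreover have "peval (Estar n lam) (tilde n \<nu>) = 0"
    if "is_comp n \<nu>" "csize n \<nu> \<le> csize n lam" "\<nu> \<notin> Sn n lam" for \<nu>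
    unfolding Estar_eq using that lam_in_Sn by (auto simp: peval_mult peval_lagrange)
  moreover have "poly_in {..<n} (Suc (csize n lam)) (Estar n lam)"
    unfolding Estar_eq by (intro poly_in_Cst_mult poly_in_lagrange)
  ultimately show ?thesis unfolding fstar_like_def by blast
qed

lemma fstar_like_Top:
  assumes g: "fstar_like g \<mu>" and i: "Suc i < n" and desc: "\<mu> i > \<mu> (Suc i)"
  shows "fstar_like (Top i g) (\<mu> \<circ> Transposition.transpose i (Suc i))"
proof -
  let ?s = "Transposition.transpose i (Suc i)"
  have s: "?s permutes {..<n}" by (rule transpose_permutes[OF i])
  have ss: "\<rho> \<circ> ?s \<circ> ?s = \<rho>" for \<rho> :: "nat \<Rightarrow> nat" by (simp add: comp_assoc)
  have ne: "\<mu> \<circ> ?s \<noteq> \<mu>"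
  proof
    assume "\<mu> \<circ> ?s = \<mu>"
    from fun_cong[OF this, of i] show False using desc by simp
  qed
  have dom: "top_dominated n g lam" and coef: "\<And>\<tau>. \<tau> \<in> Sn n lam \<Longrightarrow> coeffx g \<tau> = (if \<tau> = \<mu> then 1 else 0)"
    and van: "\<And>\<nu>. is_comp n \<nu> \<Longrightarrow> csize n \<nu> \<le> csize n lam \<Longrightarrow> \<nu> \<notin> Sn n lam \<Longrightarrow> peval g (tilde n \<nu>) = 0"
    and pin: "poly_in {..<n} (Suc (csize n lam)) g"
    using g by (auto simp: fstar_like_def)
  have "poly_in {..<n} (Suc (csize n lam)) (Top i g)" by (rule poly_in_Top[OF pin]) (use i in auto)
  moreover have "peval (Top i g) (tilde n \<nu>) = 0"
    if \<nu>: "is_comp n \<nu>" "csize n \<nu> \<le> csize n lam" "\<nu> \<notin> Sn n lam" for \<nu>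
  proof (rule peval_Top_tilde_zero[OF i van[OF \<nu>]])
    have "\<nu> \<circ> ?s \<notin> Sn n lam" using Sn_permute[OF _ s, of "\<nu> \<circ> ?s"] \<nu>(3) unfolding ss by blast
    then show "peval g (tilde n (\<nu> \<circ> ?s)) = 0"
      using \<nu> is_comp_permute[OF s] csize_permute[OF s, of \<nu>] by (intro van) auto
  qed
  moreover have "coeffx (Top i g) \<tau> = (if \<tau> = \<mu> \<circ> ?s then 1 else 0)" if \<tau>: "\<tau> \<in> Sn n lam" for \<tau>
  proof -
    have sw: "\<tau> \<circ> ?s = \<mu> \<longleftrightarrow> \<tau> = \<mu> \<circ> ?s" using ss[of \<tau>] ss[of \<mu>] by auto
    have "coeffx (Top i g) \<tau> = (if \<tau> i < \<tau> (Suc i) then coeffx g (\<tau> \<circ> ?s) + (tt - 1) * coeffx g \<tau>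
        else tt * coeffx g (\<tau> \<circ> ?s))"
      by (rule coeffx_Top_orbit[OF dom i Sn_props(1,2)[OF \<tau>]])
    also have "\<dots> = (if \<tau> i < \<tau> (Suc i) then (if \<tau> = \<mu> \<circ> ?s then 1 else 0) + (tt - 1) * (if \<tau> = \<mu> then 1 else 0)
        else tt * (if \<tau> = \<mu> \<circ> ?s then 1 else 0))"
      unfolding coef[OF \<tau>] coef[OF Sn_permute[OF \<tau> s]] sw ..
    \<comment> \<open>\<open>\<mu>\<close> has a descent at \<open>i\<close> and its swap an ascent,
      so the factors \<open>tt - 1\<close> and \<open>tt\<close> meet only zero
      coefficients.\<close>
    also have "\<dots> = (if \<tau> = \<mu> \<circ> ?s then 1 else 0)"
      using desc ne by auto
    finally show ?thesis .
  qed
  moreover have "top_dominated n (Top i g) lam" by (rule top_dominated_Top[OF dom i])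
  ultimately show ?thesis unfolding fstar_like_def by blast
qed

text \<open>Each letter adds at most one ascent, so a word as long as the number of ascents reached
  applies every letter at a descent.\<close>

lemma fstar_like_word:
  assumes "\<forall>i\<in>set w. Suc i < n" "length w = asc n (act (word_perm w) lam)"
  shows "fstar_like (foldr Top w (Estar n lam)) (act (word_perm w) lam)"
  using assms
proof (induction w)
  case Nil
  then show ?case using fstar_like_Estar by (simp add: act_def word_perm_Nil)
next
  case (Cons i w)
  let ?\<nu> = "act (word_perm w) lam"
  have i: "Suc i < n" and w: "\<forall>i\<in>set w. Suc i < n" using Cons.prems by auto
  have eq: "act (word_perm (i # w)) lam = ?\<nu> \<circ> Transposition.transpose i (Suc i)"
    unfolding word_perm_Cons by (rule act_transpose_comp[OF word_perm_permutes[OF w]])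
  have asc: "Suc (length w) = asc n (?\<nu> \<circ> Transposition.transpose i (Suc i))"
    using Cons.prems(2) unfolding eq by (simp only: length_Cons)
  have le: "asc n ?\<nu> \<le> length w" by (rule asc_act_word_le[OF w asc_partition])
  have desc: "?\<nu> i > ?\<nu> (Suc i)"
  proof (cases "?\<nu> i" "?\<nu> (Suc i)" rule: linorder_cases)
    case less
    from asc_transpose'[of i n ?\<nu>, OF i less] show ?thesis using le asc by linarith
  next
    case equal
    from transpose_fix[OF equal] show ?thesis using le asc by simp
  qed
  have "length w = asc n ?\<nu>" using asc_transpose[of i n ?\<nu>, OF i desc] asc by linarith
  then have "fstar_like (foldr Top w (Estar n lam)) ?\<nu>" using Cons.IH w by blast
  then show ?case unfolding eq foldr_Cons o_apply[of "Top i"] by (rule fstar_like_Top[OF _ i desc])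
qed

lemma fchar_fstar:
  assumes \<mu>: "\<mu> \<in> Sn n lam"
  shows "fchar n lam \<mu> (fstar n lam \<mu>)"
proof -
  \<comment> \<open>The argument covers every reduced word, in particular the one picked by
    \<open>SOME\<close>.\<close>
  define w where "w = (SOME w. reduced_word n (sigma_of n lam \<mu>) w)"
  have red: "reduced_word n (sigma_of n lam \<mu>) w"
    unfolding w_def by (rule someI_ex[OF sigma_of_reduced_word(1)[OF \<mu>]])
  then have w: "act (word_perm w) lam = \<mu>" "length w = asc n \<mu>"
    using sigma_of_reduced_word(2)[OF \<mu>] by auto
  have "fstar_like (foldr Top w (Estar n lam)) \<mu>"
    using fstar_like_word[of w] w red by (simp add: reduced_word_def)
  then show ?thesis
    using fstar_like_fchar[OF _ \<mu>] by (simp add: fstar_def Tperm_def w_def)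
qed

text \<open>Such a \<open>g\<close> is a combination of the \<open>lagrange n \<mu>\<close> over the
  orbit. At a \<open>\<rho>\<close> with the most ascents among the terms that occur, triangularity
  leaves a single contribution to the coefficient of \<open>x^\<rho>\<close>, which is
  nonzero.\<close>

lemma zero_if_orbit_coeffs_zero:
  assumes g: "poly_in {..<n} (Suc (csize n lam)) g"
    and van: "\<And>\<nu>. is_comp n \<nu> \<Longrightarrow> csize n \<nu> \<le> csize n lam \<Longrightarrow> \<nu> \<notin> Sn n lam \<Longrightarrow> peval g (tilde n \<nu>) = 0"
    and coef: "\<And>\<tau>. \<tau> \<in> Sn n lam \<Longrightarrow> coeffx g \<tau> = 0"
  shows "g = 0"
proof -
  define a where "a \<mu> = peval g (tilde n \<mu>)" for \<mu>
  have "g - (\<Sum>\<mu>\<in>Sn n lam. Cst (a \<mu>) * lagrange n \<mu>) = 0"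
  proof (rule poly_eq_zero_if_vanishing[of n "csize n lam"])
    have "poly_in {..<n} (Suc (csize n lam)) (lagrange n \<mu>)" if "\<mu> \<in> Sn n lam" for \<mu>
      using poly_in_lagrange[of n \<mu>] Sn_props(3)[OF that] by simp
    then show "poly_in {..<n} (Suc (csize n lam)) (g - (\<Sum>\<mu>\<in>Sn n lam. Cst (a \<mu>) * lagrange n \<mu>))"
      by (intro poly_in_minus g poly_in_sum poly_in_Cst_mult)
    fix \<nu> assume \<nu>: "is_comp n \<nu>" "csize n \<nu> \<le> csize n lam"
    have "(\<Sum>\<mu>\<in>Sn n lam. a \<mu> * peval (lagrange n \<mu>) (tilde n \<nu>)) = (\<Sum>\<mu>\<in>Sn n lam. if \<mu> = \<nu> then a \<nu> else 0)"
      by (rule sum.cong) (use \<nu> Sn_props(3) in \<open>auto simp: peval_lagrange\<close>)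
    also have "\<dots> = a \<nu>" using finite_Sn van[OF \<nu>] by (simp add: a_def)
    finally show "peval (g - (\<Sum>\<mu>\<in>Sn n lam. Cst (a \<mu>) * lagrange n \<mu>)) (tilde n \<nu>) = 0"
      by (simp add: peval_minus peval_sum peval_mult a_def)
  qed
  then have expand: "g = (\<Sum>\<mu>\<in>Sn n lam. Cst (a \<mu>) * lagrange n \<mu>)" by simp
  have "a \<mu> = 0" if "\<mu> \<in> Sn n lam" for \<mu>
  proof (rule ccontr)
    let ?B = "{\<mu> \<in> Sn n lam. a \<mu> \<noteq> 0}"
    assume "a \<mu> \<noteq> 0"
    then have "?B \<noteq> {}" using that by blast
    moreover have "finite ?B" using finite_Sn by simp
    ultimately have "Max (asc n ` ?B) \<in> asc n ` ?B" "\<And>\<nu>. \<nu> \<in> ?B \<Longrightarrow> asc n \<nu> \<le> Max (asc n ` ?B)"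
      by (intro Max_in Max_ge; simp)+
    then obtain \<rho> where \<rho>: "\<rho> \<in> ?B" "\<And>\<nu>. \<nu> \<in> ?B \<Longrightarrow> asc n \<nu> \<le> asc n \<rho>"
      by (metis (no_types, lifting) imageE)
    have "coeffx g \<rho> = (\<Sum>\<nu>\<in>Sn n lam. a \<nu> * coeffx (lagrange n \<nu>) \<rho>)"
      by (subst expand) (simp add: coeffx_sum)
    also have "\<dots> = (\<Sum>\<nu>\<in>Sn n lam. if \<nu> = \<rho> then a \<rho> * coeffx (lagrange n \<rho>) \<rho> else 0)"
    proof (rule sum.cong[OF refl])
      fix \<nu> assume \<nu>: "\<nu> \<in> Sn n lam"
      have "coeffx (lagrange n \<nu>) \<rho> = 0" if "\<nu> \<noteq> \<rho>" "a \<nu> \<noteq> 0"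
      proof -
        have "asc n \<nu> \<le> asc n \<rho>" using \<rho>(2)[of \<nu>] \<nu> that(2) by simp
        moreover have "is_comp n \<rho>" "profile n \<rho> = profile n \<nu>"
          using Sn_props[of \<rho>] Sn_props[OF \<nu>] \<rho>(1) by auto
        ultimately show ?thesis
          using triangular[OF Sn_props(1)[OF \<nu>]] that(1) unfolding triangular_def by metis
      qed
      then show "a \<nu> * coeffx (lagrange n \<nu>) \<rho> = (if \<nu> = \<rho> then a \<rho> * coeffx (lagrange n \<rho>) \<rho> else 0)"
        by auto
    qed
    also have "\<dots> = a \<rho> * coeffx (lagrange n \<rho>) \<rho>" using finite_Sn \<rho>(1) by simp
    finally have "a \<rho> * coeffx (lagrange n \<rho>) \<rho> = 0" using coef \<rho>(1) by simp
    moreover have "coeffx (lagrange n \<rho>) \<rho> \<noteq> 0"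
      using triangular[OF Sn_props(1)] \<rho>(1) by (simp add: triangular_def)
    ultimately show False using \<rho>(1) by simp
  qed
  then show ?thesis by (subst expand) (simp add: Cst_def)
qed

end

theorem theorem2p17:
  fixes n :: nat and lam \<mu> :: "nat \<Rightarrow> nat"
  assumes "is_partition n lam" and "\<mu> \<in> Sn n lam"
  shows "fchar n lam \<mu> (fstar n lam \<mu>) \<and> (\<forall>g. fchar n lam \<mu> g \<longrightarrow> g = fstar n lam \<mu>)"
proof (intro conjI allI impI)
  show f: "fchar n lam \<mu> (fstar n lam \<mu>)" by (rule fchar_fstar[OF assms])
  fix g assume g: "fchar n lam \<mu> g"
  have size: "csize n \<mu> = csize n lam" by (rule Sn_props(3)[OF assms])
  have "g - fstar n lam \<mu> = 0"
  proof (rule zero_if_orbit_coeffs_zero[OF assms(1)])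
    show "poly_in {..<n} (Suc (csize n lam)) (g - fstar n lam \<mu>)"
      using f g by (intro poly_in_minus) (auto simp: fchar_def size poly_in_iff)
    show "peval (g - fstar n lam \<mu>) (tilde n \<nu>) = 0"
      if "is_comp n \<nu>" "csize n \<nu> \<le> csize n lam" "\<nu> \<notin> Sn n lam" for \<nu>
      using f g that by (simp add: fchar_def size peval_minus)
    show "coeffx (g - fstar n lam \<mu>) \<tau> = 0" if "\<tau> \<in> Sn n lam" for \<tau>
    proof -
      have "coeffx g \<tau> = coeffx (fstar n lam \<mu>) \<tau>" using f g that by (simp add: fchar_def)
      then show ?thesis by (simp add: coeffx_def lookup_minus)
    qed
  qed
  then show "g = fstar n lam \<mu>" by simp
qed

end
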